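(* Suppose $\mathrm{Ker}_1\phi=0$ and $\dim\bar D=\infty$. Let $\Gamma$ be a simple bounded $W$-module. Then one of the following holds: (1) $\Gamma\cong\Gamma(V^c,\sigma)$, where $c\in\mathbb C$, $\sigma\in D^*$, with $\sigma\notin G$ or $c\notin\{0,1\}$; (2) $\Gamma\cong\Gamma(\sigma,1)$ or $\Gamma\cong\Gamma(\sigma,\infty)$, where $\sigma\in G$; (3) $\Gamma$ is the one dimensional trivial module.
   Context: Let $G$ be a nonzero abelian group, $D$ a complex vector space, $\phi:G\times D\to\mathbb C$ additive in the first variable and $\mathbb C$-linear in the second; write $d(a)=a(d)=\phi(a,d)$. $\mathrm{Ker}_1\phi=\{a\in G\mid\phi(a,D)=0\}$, $\mathrm{Ker}_2\phi=\{d\in D\mid\phi(G,d)=0\}$, and $\bar D$ is a fixed complement: $D=\bar D\oplus\mathrm{Ker}_2\phi$. When $\mathrm{Ker}_1\phi=0$, $G$ is identified with a subgroup of $D^*$ via $a\mapsto\phi(a,-)$. Let $A=\mathbb C[G]$ with basis $t^a$. The generalized Witt algebra $W=A\otimes_{\mathbb C}D$ has bracket $[t^ad,t^{a'}d']=t^{a+a'}(\phi(a',d)d'-\phi(a,d')d)$, where $t^ad=t^a\otimes d$ and $d=t^0\otimes d$. A $W$-module $M$ is a weight module if $M=\bigoplus_{\lambda\in D^*}M_\lambda$, $M_\lambda=\{v\mid d\cdot v=\lambda(d)v\ \forall d\in D\}$; it is bounded if it is a weight module and the dimensions $\dim M_\lambda$ are uniformly bounded. For $c\in\mathbb C$ and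 $\sigma\in D^*$, let $V^c=\mathbb Cv$ and let $\Gamma(V^c,\sigma)=A\otimes V^c$ be the $W$-module with $t^ad\cdot(t^b\otimes v)=(d(b)+\sigma(d)+c\,\phi(a,d))\,t^{a+b}\otimes v$. For $\sigma\in G$, $\Gamma(\sigma,1)=\Gamma(V^0,\sigma)/(\mathbb Ct^{-\sigma}\otimes V^0)$ and $\Gamma(\sigma,\infty)=\bigoplus_{a\in G,a\ne-\sigma}\mathbb Ct^a\otimes V^1\subset\Gamma(V^1,\sigma)$. *)

theory Defs
  imports Complex_Main "HOL-Library.Poly_Mapping"
begin

text \<open>
  The group \<open>G\<close> is a type of class \<open>ab_group_add\<close>; complex vector spaces are given by a scalar
  multiplication satisfying the library locale \<open>vector_space\<close>.
  The space \<open>\<complex>[G] \<otimes> D\<close> is represented by the finitely supported functions \<open>G \<Rightarrow>\<^sub>0 D\<close>, with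
  \<open>t\<^sup>a \<otimes> d\<close> being \<open>Poly_Mapping.single a d\<close>; likewise \<open>\<complex>[G] \<otimes> \<complex>v\<close> is \<open>G \<Rightarrow>\<^sub>0 complex\<close>, with
  \<open>t\<^sup>b \<otimes> v\<close> being \<open>Poly_Mapping.single b 1\<close>.
\<close>

definition lin_dual :: "(complex \<Rightarrow> 'd \<Rightarrow> 'd::ab_group_add) \<Rightarrow> ('d \<Rightarrow> complex) set" where
  "lin_dual sD = {l. Vector_Spaces.linear sD (*) l}"

text \<open>Intended for subspaces \<open>V\<close>. (The library's \<open>dim\<close> is \<open>0\<close> on infinite-dimensional spaces.)\<close>
definition fin_dim :: "(complex \<Rightarrow> 'v \<Rightarrow> 'v::ab_group_add) \<Rightarrow> 'v set \<Rightarrow> bool" where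
  "fin_dim s V \<longleftrightarrow> (\<exists>B. finite B \<and> module.span s B = V)"

definition Ker1 :: "('g::ab_group_add \<Rightarrow> 'd \<Rightarrow> complex) \<Rightarrow> 'g set" where
  "Ker1 \<phi> = {a. \<forall>d. \<phi> a d = 0}"

definition Ker2 :: "('g::ab_group_add \<Rightarrow> 'd \<Rightarrow> complex) \<Rightarrow> 'd set" where
  "Ker2 \<phi> = {d. \<forall>a. \<phi> a d = 0}"

subsection \<open>The generalized Witt algebra\<close>

definition scaleW ::
  "(complex \<Rightarrow> 'd \<Rightarrow> 'd::ab_group_add) \<Rightarrow> complex \<Rightarrow> ('g \<Rightarrow>\<^sub>0 'd) \<Rightarrow> ('g \<Rightarrow>\<^sub>0 'd)" where
  "scaleW sD z x = Poly_Mapping.map (sD z) x"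

definition bracketW ::
  "(complex \<Rightarrow> 'd \<Rightarrow> 'd::ab_group_add) \<Rightarrow> ('g::ab_group_add \<Rightarrow> 'd \<Rightarrow> complex)
    \<Rightarrow> ('g \<Rightarrow>\<^sub>0 'd) \<Rightarrow> ('g \<Rightarrow>\<^sub>0 'd) \<Rightarrow> ('g \<Rightarrow>\<^sub>0 'd)" where
  "bracketW sD \<phi> x y =
    (\<Sum>a\<in>Poly_Mapping.keys x. \<Sum>a'\<in>Poly_Mapping.keys y.
      (let d = Poly_Mapping.lookup x a; d' = Poly_Mapping.lookup y a'
       in Poly_Mapping.single (a + a') (sD (\<phi> a' d) d' - sD (\<phi> a d') d)))"

definition W_module ::
  "(complex \<Rightarrow> 'd \<Rightarrow> 'd::ab_group_add) \<Rightarrow> ('g::ab_group_add \<Rightarrow> 'd \<Rightarrow> complex)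
    \<Rightarrow> (complex \<Rightarrow> 'm \<Rightarrow> 'm::ab_group_add) \<Rightarrow> (('g \<Rightarrow>\<^sub>0 'd) \<Rightarrow> 'm \<Rightarrow> 'm) \<Rightarrow> bool" where
  "W_module sD \<phi> sM act \<longleftrightarrow>
    vector_space sM \<and>
    (\<forall>x. Vector_Spaces.linear sM sM (act x)) \<and>
    (\<forall>v. Vector_Spaces.linear (scaleW sD) sM (\<lambda>x. act x v)) \<and>
    (\<forall>x y v. act (bracketW sD \<phi> x y) v = act x (act y v) - act y (act x v))"

definition submodule ::
  "(complex \<Rightarrow> 'm \<Rightarrow> 'm::ab_group_add) \<Rightarrow> ('w \<Rightarrow> 'm \<Rightarrow> 'm) \<Rightarrow> 'm set \<Rightarrow> bool" where
  "submodule sM act N \<longleftrightarrow> module.subspace sM N \<and> (\<forall>x. \<forall>v\<in>N. act x v \<in> N)"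

definition simple_module ::
  "(complex \<Rightarrow> 'm \<Rightarrow> 'm::ab_group_add) \<Rightarrow> ('w \<Rightarrow> 'm \<Rightarrow> 'm) \<Rightarrow> bool" where
  "simple_module sM act \<longleftrightarrow>
    (\<exists>v::'m. v \<noteq> 0) \<and> (\<forall>N. submodule sM act N \<longrightarrow> N = {0} \<or> N = UNIV)"

definition weight_space ::
  "(complex \<Rightarrow> 'm \<Rightarrow> 'm::ab_group_add) \<Rightarrow> (('g::zero \<Rightarrow>\<^sub>0 'd::zero) \<Rightarrow> 'm \<Rightarrow> 'm)
    \<Rightarrow> ('d \<Rightarrow> complex) \<Rightarrow> 'm set" where
  "weight_space sM act l = {v. \<forall>d. act (Poly_Mapping.single 0 d) v = sM (l d) v}"

text \<open>\<open>M\<close> is the (internal) direct sum of its weight spaces: each vector has a unique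
  decomposition with finitely many nonzero components.\<close>
definition weight_module ::
  "(complex \<Rightarrow> 'd \<Rightarrow> 'd::ab_group_add) \<Rightarrow> (complex \<Rightarrow> 'm \<Rightarrow> 'm::ab_group_add)
    \<Rightarrow> (('g::zero \<Rightarrow>\<^sub>0 'd) \<Rightarrow> 'm \<Rightarrow> 'm) \<Rightarrow> bool" where
  "weight_module sD sM act \<longleftrightarrow>
    (\<forall>v. \<exists>!f :: ('d \<Rightarrow> complex) \<Rightarrow> 'm.
      finite {l. f l \<noteq> 0} \<and> {l. f l \<noteq> 0} \<subseteq> lin_dual sD \<and>
      (\<forall>l. f l \<in> weight_space sM act l) \<and>
      v = (\<Sum>l | f l \<noteq> 0. f l))"

definition bounded_module ::
  "(complex \<Rightarrow> 'd \<Rightarrow> 'd::ab_group_add) \<Rightarrow> (complex \<Rightarrow> 'm \<Rightarrow> 'm::ab_group_add)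
    \<Rightarrow> (('g::zero \<Rightarrow>\<^sub>0 'd) \<Rightarrow> 'm \<Rightarrow> 'm) \<Rightarrow> bool" where
  "bounded_module sD sM act \<longleftrightarrow>
    weight_module sD sM act \<and>
    (\<exists>n. \<forall>l\<in>lin_dual sD.
      fin_dim sM (weight_space sM act l) \<and> vector_space.dim sM (weight_space sM act l) \<le> n)"

subsection \<open>Module structures with explicit carrier\<close>

text \<open>Needed because the modules \<open>\<Gamma>(\<sigma>,1)\<close> and \<open>\<Gamma>(\<sigma>,\<infinity>)\<close> live on a quotient resp. a subset that
  depends on \<open>\<sigma>\<close>.\<close>
record ('w, 'm) module_struct =
  carr :: "'m set"
  madd :: "'m \<Rightarrow> 'm \<Rightarrow> 'm"
  msmult :: "complex \<Rightarrow> 'm \<Rightarrow> 'm"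
  mact :: "'w \<Rightarrow> 'm \<Rightarrow> 'm"

definition full_struct ::
  "(complex \<Rightarrow> 'm \<Rightarrow> 'm::ab_group_add) \<Rightarrow> ('w \<Rightarrow> 'm \<Rightarrow> 'm) \<Rightarrow> ('w, 'm) module_struct" where
  "full_struct sM act = \<lparr>carr = UNIV, madd = (+), msmult = sM, mact = act\<rparr>"

definition sub_struct ::
  "(complex \<Rightarrow> 'm \<Rightarrow> 'm::ab_group_add) \<Rightarrow> ('w \<Rightarrow> 'm \<Rightarrow> 'm) \<Rightarrow> 'm set \<Rightarrow> ('w, 'm) module_struct" where
  "sub_struct sM act N = \<lparr>carr = N, madd = (+), msmult = sM, mact = act\<rparr>"

definition quot_struct ::
  "(complex \<Rightarrow> 'm \<Rightarrow> 'm::ab_group_add) \<Rightarrow> ('w \<Rightarrow> 'm \<Rightarrow> 'm) \<Rightarrow> 'm set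
    \<Rightarrow> ('w, 'm set) module_struct" where
  "quot_struct sM act N =
    (let r = {(x, y). x - y \<in> N} in
     \<lparr>carr = UNIV // r,
      madd = (\<lambda>X Y. \<Union>x\<in>X. \<Union>y\<in>Y. r `` {x + y}),
      msmult = (\<lambda>z X. \<Union>x\<in>X. r `` {sM z x}),
      mact = (\<lambda>w X. \<Union>x\<in>X. r `` {act w x})\<rparr>)"

definition module_iso ::
  "('w, 'm) module_struct \<Rightarrow> ('w, 'n) module_struct \<Rightarrow> bool" (infix "\<cong>\<^sub>W" 50) where
  "M \<cong>\<^sub>W N \<longleftrightarrow>
    (\<exists>F. bij_betw F (carr M) (carr N) \<and>
      (\<forall>x\<in>carr M. \<forall>y\<in>carr M. F (madd M x y) = madd N (F x) (F y)) \<and>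
      (\<forall>z. \<forall>x\<in>carr M. F (msmult M z x) = msmult N z (F x)) \<and>
      (\<forall>w. \<forall>x\<in>carr M. F (mact M w x) = mact N w (F x)))"

subsection \<open>The modules \<open>\<Gamma>(V\<^sup>c,\<sigma>)\<close>, \<open>\<Gamma>(\<sigma>,1)\<close> and \<open>\<Gamma>(\<sigma>,\<infinity>)\<close>\<close>

definition scaleA :: "complex \<Rightarrow> ('g \<Rightarrow>\<^sub>0 complex) \<Rightarrow> ('g \<Rightarrow>\<^sub>0 complex)" where
  "scaleA z f = Poly_Mapping.map ((*) z) f"

definition Gamma_act ::
  "('g::ab_group_add \<Rightarrow> 'd \<Rightarrow> complex) \<Rightarrow> complex \<Rightarrow> ('d \<Rightarrow> complex)
    \<Rightarrow> ('g \<Rightarrow>\<^sub>0 'd::ab_group_add) \<Rightarrow> ('g \<Rightarrow>\<^sub>0 complex) \<Rightarrow> ('g \<Rightarrow>\<^sub>0 complex)" where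
  "Gamma_act \<phi> c \<sigma> w f =
    (\<Sum>a\<in>Poly_Mapping.keys w. \<Sum>b\<in>Poly_Mapping.keys f.
      (let d = Poly_Mapping.lookup w a
       in Poly_Mapping.single (a + b) ((\<phi> b d + \<sigma> d + c * \<phi> a d) * Poly_Mapping.lookup f b)))"

definition Gamma ::
  "('g::ab_group_add \<Rightarrow> 'd::ab_group_add \<Rightarrow> complex) \<Rightarrow> complex \<Rightarrow> ('d \<Rightarrow> complex)
    \<Rightarrow> ('g \<Rightarrow>\<^sub>0 'd, 'g \<Rightarrow>\<^sub>0 complex) module_struct" where
  "Gamma \<phi> c \<sigma> = full_struct scaleA (Gamma_act \<phi> c \<sigma>)"

text \<open>In the next two definitions the element \<open>\<sigma>\<close> of \<open>G \<subseteq> D\<^sup>*\<close> is given by \<open>s :: 'g\<close>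
  with \<open>\<sigma> = \<phi> s\<close>.\<close>

definition Gamma_one ::
  "('g::ab_group_add \<Rightarrow> 'd::ab_group_add \<Rightarrow> complex) \<Rightarrow> 'g
    \<Rightarrow> ('g \<Rightarrow>\<^sub>0 'd, ('g \<Rightarrow>\<^sub>0 complex) set) module_struct" where
  "Gamma_one \<phi> s =
    quot_struct scaleA (Gamma_act \<phi> 0 (\<phi> s)) (range (Poly_Mapping.single (- s)))"

definition Gamma_inf ::
  "('g::ab_group_add \<Rightarrow> 'd::ab_group_add \<Rightarrow> complex) \<Rightarrow> 'g
    \<Rightarrow> ('g \<Rightarrow>\<^sub>0 'd, 'g \<Rightarrow>\<^sub>0 complex) module_struct" where
  "Gamma_inf \<phi> s =
    sub_struct scaleA (Gamma_act \<phi> 1 (\<phi> s)) {f. Poly_Mapping.keys f \<subseteq> {a. a \<noteq> - s}}"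

subsection \<open>The defining formulas on the generators \<open>t\<^sup>a d\<close>\<close>

lemma lookup_scaleW:
  assumes "vector_space sD"
  shows "Poly_Mapping.lookup (scaleW sD z x) a = sD z (Poly_Mapping.lookup x a)"
proof -
  interpret vector_space sD by fact
  show ?thesis by (simp add: scaleW_def Poly_Mapping.map.rep_eq when_def)
qed

lemma vector_space_scaleW:
  assumes "vector_space sD"
  shows "vector_space (scaleW sD :: complex \<Rightarrow> ('g \<Rightarrow>\<^sub>0 'd::ab_group_add) \<Rightarrow> _)"
proof -
  interpret vector_space sD by fact
  show ?thesis
    by unfold_locales
      (auto intro!: poly_mapping_eqI
        simp: lookup_scaleW[OF assms] Poly_Mapping.lookup_add scale_right_distrib scale_left_distrib)
qed

lemma bracketW_single:
  assumes "\<And>a. Vector_Spaces.linear sD (*) (\<phi> a)"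
  shows "bracketW sD \<phi> (Poly_Mapping.single a d) (Poly_Mapping.single a' d') =
    Poly_Mapping.single (a + a') (sD (\<phi> a' d) d' - sD (\<phi> a d') d)"
proof -
  interpret Vector_Spaces.linear sD "(*)" "\<phi> a" for a by (rule assms)
  show ?thesis
    by (cases "d = 0"; cases "d' = 0") (auto simp: bracketW_def zero)
qed

lemma Gamma_act_single:
  assumes "\<And>a. Vector_Spaces.linear sD (*) (\<phi> a)" "\<sigma> \<in> lin_dual sD"
  shows "Gamma_act \<phi> c \<sigma> (Poly_Mapping.single a d) (Poly_Mapping.single b 1) =
    Poly_Mapping.single (a + b) (\<phi> b d + \<sigma> d + c * \<phi> a d)"
proof -
  interpret Vector_Spaces.linear sD "(*)" "\<phi> a" for a by (rule assms)
  interpret s: Vector_Spaces.linear sD "(*)" \<sigma> using assms(2) by (simp add: lin_dual_def)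
  show ?thesis
    by (cases "d = 0") (auto simp: Gamma_act_def zero s.zero)
qed

end

(*
  Fix a weight l. The annihilators {d. t^a d M_l = 0} have bounded codimension and together form a
  graded subalgebra of W; since the span of G in D^* is infinite dimensional, this forces a common
  finite-dimensional E in D^* such that t^a d kills M_l whenever a is not in E, d annihilates E and
  a(d) = 0. For such d the commutator [t^a d, t^b d'] acts on M_l like multiplication by t^a, which
  identifies the spaces t^b D M_l for all b outside E with one finite-dimensional space Q.

  For a weight l of maximal dim Q, every vector m of weight l + b (b not in E) has an expansion
  t^a d m = t^a (s0(d) + a(d) s1) for all generic a. Commutator identities turn this into
  t^a d (t^b q) = t^(a+b) ((b + l)(d) q + a(d) C q) with a fixed operator C on Q. An eigenvector of
  C spans a copy of the generic part of a module Gamma(V^c, l) inside M. As a vector killed by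
  t^a D for all generic a is killed by W, the remaining basis vectors of M, and the action on them,
  are determined by the generic part.
*)

theory Submission
  imports Defs "HOL-Library.Function_Algebras" "HOL-Computational_Algebra.Fundamental_Theorem_Algebra"
begin

text \<open>Identities are available only for group elements in general position, hence the filter
  \<open>gen\<close>; it is proper because \<phi> stays nonzero on the annihilator of any finite set
  of functionals. Other degrees are reached by commutators of elements of generic degree. A common E
  exists for this reason: a functional f vanishing on the annihilator in degree a + b satisfies b(d)
  f(d') = a(d') f(d) for d, d' in the annihilators of degrees a and b. If E failed to exist, this
  would produce annihilators on which more and more independent functionals vanish, against their
  codimension being at most \<open>N * N\<close>, where N bounds the weight multiplicities.
  Maximality of dim Q keeps t^a D from mapping M_(l+b) outside the transported copies of Q:
  otherwise the weight l + b would have larger rank. That the part of the action independent of a is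
  the weight itself comes from [t^a d, t^(-a) d] = -2 a(d) d. The values 0 and 1 of c are special
  because (b + l)(d) + c a(d) vanishes for all a with the source b fixed only if c = 0, and with the
  target a + b fixed only if c = 1.\<close>

interpretation dual: vector_space "\<lambda>c (f::'d \<Rightarrow> complex) d. c * f d"
  by unfold_locales (auto simp: fun_eq_iff algebra_simps)

subsection \<open>Linear functionals and generic group elements\<close>

lemma lin_dual_iff:
  assumes "vector_space sD"
  shows "f \<in> lin_dual sD \<longleftrightarrow> (\<forall>x y. f (x + y) = f x + f y) \<and> (\<forall>c x. f (sD c x) = c * f x)"
proof -
  have "vector_space ((*) :: complex \<Rightarrow> complex \<Rightarrow> complex)"
    by unfold_locales (auto simp: algebra_simps)
  with assms show ?thesis
    by (auto simp: lin_dual_def Vector_Spaces.linear_iff)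
qed

text \<open>\<open>generic_ex\<close> says that no finite-dimensional subspace of D^* contains all
  \<open>\<phi> a\<close>. In this form the infinite dimension of the complement of
  \<open>Ker2 \<phi>\<close> enters.\<close>

locale pairing = D: vector_space sD
  for sD :: "complex \<Rightarrow> 'd \<Rightarrow> 'd::ab_group_add" +
  fixes \<phi> :: "'g::ab_group_add \<Rightarrow> 'd \<Rightarrow> complex"
  assumes phi_add: "\<phi> (a + b) d = \<phi> a d + \<phi> b d"
    and phi_dual: "\<phi> a \<in> lin_dual sD"
    and generic_ex: "\<lbrakk>finite B; B \<subseteq> lin_dual sD\<rbrakk> \<Longrightarrow> \<exists>a d. (\<forall>f\<in>B. f d = 0) \<and> \<phi> a d \<noteq> 0"
begin

lemma dual_add: "f \<in> lin_dual sD \<Longrightarrow> f (x + y) = f x + f y"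
  and dual_scale: "f \<in> lin_dual sD \<Longrightarrow> f (sD c x) = c * f x"
  by (auto simp: lin_dual_iff[OF D.vector_space_axioms])

lemma dual_zero: "f \<in> lin_dual sD \<Longrightarrow> f 0 = 0"
  using dual_scale[of f 0 0] by simp

lemma dual_diff: "f \<in> lin_dual sD \<Longrightarrow> f (x - y) = f x - f y"
  by (metis add_diff_cancel diff_add_cancel dual_add)

lemma phi_simps [simp]:
  "\<phi> (a + b) d = \<phi> a d + \<phi> b d" "\<phi> 0 d = 0" "\<phi> (- a) d = - \<phi> a d" "\<phi> (a - b) d = \<phi> a d - \<phi> b d"
  "\<phi> a (x + y) = \<phi> a x + \<phi> a y" "\<phi> a 0 = 0" "\<phi> a (x - y) = \<phi> a x - \<phi> a y"
  "\<phi> a (sD c x) = c * \<phi> a x" "\<phi> a (- x) = - \<phi> a x"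
proof -
  show z: "\<phi> 0 d = 0" for d using phi_add[of 0 0 d] by simp
  show m: "\<phi> (- a) d = - \<phi> a d" for a d
    using phi_add[of "-a" a d] z by (simp add: eq_neg_iff_add_eq_0)
  show "\<phi> (a - b) d = \<phi> a d - \<phi> b d" using phi_add[of a "-b" d] m by simp
  show "\<phi> a (- x) = - \<phi> a x"
    using dual_scale[OF phi_dual[of a], of "-1" x] by simp
qed (simp_all add: phi_add dual_add dual_diff dual_scale dual_zero phi_dual)

text \<open>\<open>van B\<close> is the annihilator of \<open>B\<close> in \<open>D\<close>; for finite \<open>B\<close>, \<open>nz B a\<close> means that
  \<open>\<phi> a\<close> is not in the span of \<open>B\<close>, and \<open>ind2\<close>, \<open>ind3\<close> express linear independence modulo that
  span. The filter \<open>gen\<close> describes what holds for all \<open>a\<close> outside some finite-dimensional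
  subspace of \<open>D\<^sup>*\<close>.\<close>

definition van :: "('d \<Rightarrow> complex) set \<Rightarrow> 'd \<Rightarrow> bool" where
  "van B d \<longleftrightarrow> (\<forall>f\<in>B. f d = 0)"

definition nz :: "('d \<Rightarrow> complex) set \<Rightarrow> 'g \<Rightarrow> bool" where
  "nz B a \<longleftrightarrow> (\<exists>d. van B d \<and> \<phi> a d \<noteq> 0)"

definition ind2 :: "('d \<Rightarrow> complex) set \<Rightarrow> 'g \<Rightarrow> 'g \<Rightarrow> bool" where
  "ind2 B a b \<longleftrightarrow> (\<forall>x y. \<exists>d. van B d \<and> \<phi> a d = x \<and> \<phi> b d = y)"

definition ind3 :: "('d \<Rightarrow> complex) set \<Rightarrow> 'g \<Rightarrow> 'g \<Rightarrow> 'g \<Rightarrow> bool" where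
  "ind3 B a b c \<longleftrightarrow> (\<forall>x y z. \<exists>d. van B d \<and> \<phi> a d = x \<and> \<phi> b d = y \<and> \<phi> c d = z)"

definition small :: "('d \<Rightarrow> complex) set \<Rightarrow> bool" where
  "small B \<longleftrightarrow> finite B \<and> B \<subseteq> lin_dual sD"

definition gen :: "'g filter" where
  "gen = (INF B\<in>{B. small B}. principal {a. nz B a})"

lemma small_simps [simp]:
  "small {}" "small (insert f B) \<longleftrightarrow> f \<in> lin_dual sD \<and> small B"
  "small (A \<union> B) \<longleftrightarrow> small A \<and> small B" "\<phi> a \<in> lin_dual sD"
  by (auto simp: small_def phi_dual)

lemma van_simps [simp]:
  "van {} d" "van (insert f B) d \<longleftrightarrow> f d = 0 \<and> van B d" "van (A \<union> B) d \<longleftrightarrow> van A d \<and> van B d"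
  by (auto simp: van_def)

lemma van_0 [simp]: "small B \<Longrightarrow> van B 0"
  by (auto simp: van_def small_def dual_zero subset_eq)

lemma van_add: "small B \<Longrightarrow> van B x \<Longrightarrow> van B y \<Longrightarrow> van B (x + y)"
  by (auto simp: van_def small_def dual_add subset_eq)

lemma van_diff: "small B \<Longrightarrow> van B x \<Longrightarrow> van B y \<Longrightarrow> van B (x - y)"
  by (auto simp: van_def small_def dual_diff subset_eq)

lemma van_scale: "small B \<Longrightarrow> van B x \<Longrightarrow> van B (sD c x)"
  by (auto simp: van_def small_def dual_scale subset_eq)

lemma van_mono: "van B d \<Longrightarrow> A \<subseteq> B \<Longrightarrow> van A d"
  by (auto simp: van_def)

lemma nz_mono: "nz B a \<Longrightarrow> A \<subseteq> B \<Longrightarrow> nz A a"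
  by (auto simp: nz_def intro: van_mono)

lemma nz_val: "nz B a \<Longrightarrow> small B \<Longrightarrow> \<exists>d. van B d \<and> \<phi> a d = x"
proof -
  assume "nz B a" "small B"
  then obtain d where "van B d" "\<phi> a d \<noteq> 0" by (auto simp: nz_def)
  then show ?thesis using \<open>small B\<close>
    by (intro exI[of _ "sD (x / \<phi> a d) d"]) (simp add: van_scale)
qed

lemma ind2_val: "ind2 B a b \<Longrightarrow> \<exists>d. van B d \<and> \<phi> a d = x \<and> \<phi> b d = y"
  by (simp add: ind2_def)

lemma ind3_val: "ind3 B a b c \<Longrightarrow> \<exists>d. van B d \<and> \<phi> a d = x \<and> \<phi> b d = y \<and> \<phi> c d = z"
  by (simp add: ind3_def)

lemma nzI: "van B d \<Longrightarrow> \<phi> a d \<noteq> 0 \<Longrightarrow> nz B a"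
  by (auto simp: nz_def)

lemma ind2I:
  assumes "small B" "nz B a" "nz (insert (\<phi> a) B) b"
  shows "ind2 B a b"
  unfolding ind2_def
proof (intro allI)
  fix x y
  obtain d where d: "van B d" "\<phi> a d = x" using nz_val assms by blast
  obtain e where e: "van B e" "\<phi> a e = 0" "\<phi> b e = y - \<phi> b d"
    using nz_val[OF assms(3), of "y - \<phi> b d"] assms by auto
  show "\<exists>d. van B d \<and> \<phi> a d = x \<and> \<phi> b d = y"
    using d e assms(1) by (intro exI[of _ "d + e"]) (simp add: van_add)
qed

lemma ind3I:
  assumes "small B" "ind2 B a b" "nz (insert (\<phi> a) (insert (\<phi> b) B)) c"
  shows "ind3 B a b c"
  unfolding ind3_def
proof (intro allI)
  fix x y z
  obtain d where d: "van B d" "\<phi> a d = x" "\<phi> b d = y" using ind2_val assms by blast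
  obtain e where e: "van B e" "\<phi> a e = 0" "\<phi> b e = 0" "\<phi> c e = z - \<phi> c d"
    using nz_val[OF assms(3), of "z - \<phi> c d"] assms by auto
  show "\<exists>d. van B d \<and> \<phi> a d = x \<and> \<phi> b d = y \<and> \<phi> c d = z"
    using d e assms(1) by (intro exI[of _ "d + e"]) (simp add: van_add)
qed

section \<open>The filter of generic group elements\<close>

lemma eventually_gen: "eventually P gen \<longleftrightarrow> (\<exists>B. small B \<and> (\<forall>a. nz B a \<longrightarrow> P a))"
  unfolding gen_def
proof (subst eventually_INF_base)
  show "{B. small B} \<noteq> {}" using small_simps(1) by blast
  show "\<exists>x\<in>{B. small B}. principal {a. nz x a} \<le> inf (principal {d. nz a d}) (principal {d. nz b d})"
    if "a \<in> {B. small B}" "b \<in> {B. small B}" for a b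
    using that by (intro bexI[of _ "a \<union> b"]) (auto intro: nz_mono)
qed (auto simp: eventually_principal)

lemma ev_nz: "small B \<Longrightarrow> \<forall>\<^sub>F a in gen. nz B a"
  by (auto simp: eventually_gen)

lemma gen_neq_bot [simp]: "gen \<noteq> bot"
proof
  assume "gen = bot"
  then have "eventually (\<lambda>_. False) gen" by simp
  then obtain B where "small B" "\<forall>a. \<not> nz B a" by (auto simp: eventually_gen)
  then show False using generic_ex[of B] by (auto simp: small_def nz_def van_def)
qed

lemma gen_ex: "\<forall>\<^sub>F a in gen. P a \<Longrightarrow> \<exists>a. P a"
  by (rule eventually_happens'[OF gen_neq_bot])

text \<open>On the annihilator of \<open>\<phi> b\<close> the functionals
  \<open>\<phi> (a + b)\<close> and \<open>\<phi> a\<close> agree, so it suffices to enlarge the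
  exceptional set by \<open>\<phi> b\<close>.\<close>

lemma ev_shift: "eventually P gen \<Longrightarrow> \<forall>\<^sub>F a in gen. P (a + b)"
proof -
  assume "eventually P gen"
  then obtain B where B: "small B" "\<And>a. nz B a \<Longrightarrow> P a" by (auto simp: eventually_gen)
  have "nz B (a + b)" if "nz (insert (\<phi> b) B) a" for a
    using that by (auto simp: nz_def)
  then show ?thesis unfolding eventually_gen
    using B by (intro exI[of _ "insert (\<phi> b) B"]) auto
qed

lemma ev_reflect: "eventually P gen \<Longrightarrow> \<forall>\<^sub>F a in gen. P (b - a)"
proof -
  assume "eventually P gen"
  then obtain B where B: "small B" "\<And>a. nz B a \<Longrightarrow> P a" by (auto simp: eventually_gen)
  have "nz B (b - a)" if "nz (insert (\<phi> b) B) a" for a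
    using that by (auto simp: nz_def)
  then show ?thesis unfolding eventually_gen
    using B by (intro exI[of _ "insert (\<phi> b) B"]) auto
qed

lemma freq_shift: "frequently (\<lambda>a. P (a - b)) gen \<Longrightarrow> frequently P gen"
  using ev_shift[of "\<lambda>a. \<not> P a" "- b"] by (auto simp: frequently_def)

lemma ev_ind2: "small B \<Longrightarrow> nz B a \<Longrightarrow> \<forall>\<^sub>F b in gen. ind2 B a b"
  using ev_nz[of "insert (\<phi> a) B"] by (auto elim: eventually_mono intro: ind2I)

lemma ev_ind3: "small B \<Longrightarrow> ind2 B a b \<Longrightarrow> \<forall>\<^sub>F c in gen. ind3 B a b c"
  using ev_nz[of "insert (\<phi> a) (insert (\<phi> b) B)"] by (auto elim: eventually_mono intro: ind3I)

text \<open>If g does not vanish on the annihilator of B, some d0 there has g(d0) = 1, and d - g(d)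
  d0 lies in the annihilator of \<open>insert g B\<close>; so f - f(d0) g falls under the induction
  hypothesis. This turns the codimension of an annihilator into a bound on independent
  functionals.\<close>

lemma dual_spanI:
  assumes "finite B" "B \<subseteq> lin_dual sD" "f \<in> lin_dual sD" "\<And>d. van B d \<Longrightarrow> f d = 0"
  shows "f \<in> dual.span B"
  using assms
proof (induction B arbitrary: f rule: finite_induct)
  case empty
  then have "f = 0" by (intro ext) simp
  then show ?case by (metis dual.span_zero)
next
  case (insert g B)
  show ?case
  proof (cases "\<forall>d. van B d \<longrightarrow> g d = 0")
    case True
    then have "f \<in> dual.span B" using insert by (intro insert.IH) auto
    then show ?thesis using dual.span_mono[of B "insert g B"] by blast
  next
    case False
    then obtain d1 where d1: "van B d1" "g d1 \<noteq> 0" by auto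
    have sB: "small B" and gL: "g \<in> lin_dual sD" using insert by (auto simp: small_def)
    define d0 where "d0 = sD (1 / g d1) d1"
    have d0: "van B d0" "g d0 = 1"
      using d1 sB gL by (auto simp: d0_def van_scale dual_scale)
    have "f - (\<lambda>d. f d0 * g d) \<in> dual.span B"
    proof (rule insert.IH)
      show "B \<subseteq> lin_dual sD" using insert by auto
      show "f - (\<lambda>d. f d0 * g d) \<in> lin_dual sD"
        using insert.prems(2) gL
        by (auto simp: lin_dual_iff[OF D.vector_space_axioms] algebra_simps)
      fix d assume d: "van B d"
      have "van (insert g B) (d - sD (g d) d0)"
        using d d0 sB gL by (auto simp: van_diff van_scale dual_diff dual_scale)
      then have "f (d - sD (g d) d0) = 0" using insert.prems by blast
      then show "(f - (\<lambda>d. f d0 * g d)) d = 0"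
        using insert.prems(2) by (simp add: dual_diff dual_scale)
    qed
    then show ?thesis
      by (auto simp: dual.span_insert)
  qed
qed

lemma nz_not_span: "small B \<Longrightarrow> nz B a \<Longrightarrow> \<phi> a \<notin> dual.span B"
proof
  assume "small B" "nz B a" "\<phi> a \<in> dual.span B"
  from \<open>nz B a\<close> obtain d where d: "van B d" "\<phi> a d \<noteq> 0" by (auto simp: nz_def)
  from \<open>\<phi> a \<in> dual.span B\<close> have "\<phi> a d = 0"
    by (induction rule: dual.span_induct_alt) (use d in \<open>auto simp: van_def\<close>)
  with d show False by simp
qed

end

subsection \<open>Annihilators of weight spaces\<close>

text \<open>The element \<open>t\<^sup>a \<otimes> d\<close> acts by \<open>t a d\<close>.\<close>

locale witt_rep = pairing sD \<phi> + M: vector_space sM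
  for sD :: "complex \<Rightarrow> 'd \<Rightarrow> 'd::ab_group_add"
    and \<phi> :: "'g::ab_group_add \<Rightarrow> 'd \<Rightarrow> complex"
    and sM :: "complex \<Rightarrow> 'm \<Rightarrow> 'm::ab_group_add" +
  fixes t :: "'g \<Rightarrow> 'd \<Rightarrow> 'm \<Rightarrow> 'm"
  assumes t_add [simp]: "t a d (v + w) = t a d v + t a d w"
    and t_scale [simp]: "t a d (sM z v) = sM z (t a d v)"
    and t_add_d [simp]: "t a (d + d') v = t a d v + t a d' v"
    and t_scale_d [simp]: "t a (sD z d) v = sM z (t a d v)"
    and t_comm: "t a d (t a' d' v) - t a' d' (t a d v) = t (a + a') (sD (\<phi> a' d) d' - sD (\<phi> a d') d) v"
begin

definition wt :: "('d \<Rightarrow> complex) \<Rightarrow> 'm set" where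
  "wt l = {v. \<forall>d. t 0 d v = sM (l d) v}"

lemma t_0 [simp]: "t a d 0 = 0"
  using t_scale[of a d 0 0] by simp

lemma t_minus [simp]: "t a d (- v) = - t a d v"
  using t_scale[of a d "-1" v] by simp

lemma t_minus_d [simp]: "t a (- d) v = - t a d v"
  using t_scale_d[of a "-1" d v] by simp

lemma t_diff [simp]: "t a d (v - w) = t a d v - t a d w"
  using t_add[of a d v "- w"] by simp

lemma t_diff_d [simp]: "t a (d - d') v = t a d v - t a d' v"
  using t_add_d[of a d "- d'" v] by simp

lemma t_comm': "t a d (t a' d' v) = t a' d' (t a d v) + sM (\<phi> a' d) (t (a + a') d' v) - sM (\<phi> a d') (t (a + a') d v)"
  using t_comm[of a d a' d' v] by (simp add: algebra_simps)

lemma subspace_wt: "M.subspace (wt l)"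
  by (auto simp: M.subspace_def wt_def algebra_simps)

lemma t_wt: "v \<in> wt l \<Longrightarrow> t a d v \<in> wt (\<lambda>x. l x + \<phi> a x)"
  unfolding wt_def
proof (intro CollectI allI)
  fix d' assume "v \<in> {v. \<forall>d. t 0 d v = sM (l d) v}"
  then show "t 0 d' (t a d v) = sM (l d' + \<phi> a d') (t a d v)"
    by (simp add: t_comm'[of 0 d' a d v] algebra_simps)
qed

lemma wt_nonzero_dual:
  assumes "v \<in> wt l" "v \<noteq> 0"
  shows "l \<in> lin_dual sD"
proof -
  have *: "sM (l d) v = t 0 d v" for d using assms by (simp add: wt_def)
  have "sM (l (x + y)) v = sM (l x + l y) v" for x y
    by (simp only: * t_add_d M.scale_left_distrib)
  moreover have "sM (l (sD c x)) v = sM (c * l x) v" for c x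
    by (simp only: * t_scale_d flip: M.scale_scale)
  ultimately show ?thesis
    using assms by (simp add: lin_dual_iff[OF D.vector_space_axioms])
qed

lemma t_span_eqI:
  assumes "\<And>x. x \<in> S \<Longrightarrow> t a d x = 0" "v \<in> M.span S"
  shows "t a d v = 0"
  using assms(2) by (induction rule: M.span_induct_alt) (auto simp: assms(1))

end

text \<open>Here l may be any function: the weight space of a nonlinear l is zero, so the empty C
  serves there.\<close>

locale bounded_witt_rep = witt_rep sD \<phi> sM t
  for sD :: "complex \<Rightarrow> 'd \<Rightarrow> 'd::ab_group_add"
    and \<phi> :: "'g::ab_group_add \<Rightarrow> 'd \<Rightarrow> complex"
    and sM :: "complex \<Rightarrow> 'm \<Rightarrow> 'm::ab_group_add"
    and t :: "'g \<Rightarrow> 'd \<Rightarrow> 'm \<Rightarrow> 'm" +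
  fixes N :: nat
  assumes bounded: "\<exists>C. finite C \<and> card C \<le> N \<and> wt l \<subseteq> M.span C"
begin

lemma wt_basis:
  obtains U where "U \<subseteq> wt l" "finite U" "card U \<le> N" "M.independent U" "wt l = M.span U"
proof -
  obtain C where C: "finite C" "card C \<le> N" "wt l \<subseteq> M.span C" using bounded by blast
  obtain U where U: "U \<subseteq> wt l" "M.independent U" "wt l \<subseteq> M.span U"
    by (rule M.maximal_independent_subset)
  then have "finite U \<and> card U \<le> card C" using C by (intro M.independent_span_bound) auto
  moreover have "M.span U \<subseteq> wt l" using U subspace_wt by (intro M.span_minimal)
  ultimately show ?thesis using U C by (intro that[of U]) auto
qed

text \<open>\<open>F l a\<close> is the space of functionals vanishing on \<open>K l a\<close>, of dimension at most \<open>N\<^sup>2\<close>.\<close>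

definition K :: "('d \<Rightarrow> complex) \<Rightarrow> 'g \<Rightarrow> 'd \<Rightarrow> bool" where
  "K l a d \<longleftrightarrow> (\<forall>v\<in>wt l. t a d v = 0)"

definition F :: "('d \<Rightarrow> complex) \<Rightarrow> 'g \<Rightarrow> ('d \<Rightarrow> complex) \<Rightarrow> bool" where
  "F l a f \<longleftrightarrow> (\<forall>d. K l a d \<longrightarrow> f d = 0)"

text \<open>The matrix entries of \<open>t a d\<close> between bases of the two weight spaces are
  linear in d, and these functionals cut out \<open>K l a\<close>. That the bound is uniform in a
  makes the counting in \<open>ev_not_F\<close> possible.\<close>

lemma K_codim: "\<exists>B. small B \<and> card B \<le> N * N \<and> (\<forall>d. K l a d \<longleftrightarrow> van B d)"
proof -
  obtain U where U: "U \<subseteq> wt l" "finite U" "card U \<le> N" "wt l = M.span U"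
    by (rule wt_basis)
  obtain C where C: "finite C" "card C \<le> N" "M.independent C" "wt (\<lambda>x. l x + \<phi> a x) = M.span C"
    by (rule wt_basis)
  have sp: "t a d u \<in> M.span C" if "u \<in> U" for d u
    using t_wt[of u l a d] U C that by auto
  define B where "B = (\<lambda>(u, c) d. M.representation C (t a d u) c) ` (U \<times> C)"
  have "card B \<le> card (U \<times> C)" unfolding B_def by (intro card_image_le) (use U C in auto)
  then have "card B \<le> N * N"
    using U C mult_le_mono[of "card U" N "card C" N] by (simp add: card_cartesian_product)
  moreover have "small B"
    using sp U C
    by (auto simp: small_def B_def lin_dual_iff[OF D.vector_space_axioms]
        M.representation_add M.representation_scale)
  moreover have "K l a d" if "van B d" for d
  proof -
    have "t a d u = 0" if "u \<in> U" for u
    proof -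
      have "(\<Sum>b\<in>C. sM (M.representation C (t a d u) b) b) = t a d u"
        using C that sp by (intro M.sum_representation_eq) auto
      moreover have "M.representation C (t a d u) b = 0" if "b \<in> C" for b
        using \<open>van B d\<close> \<open>u \<in> U\<close> that by (auto simp: van_def B_def)
      ultimately show ?thesis by simp
    qed
    then show ?thesis unfolding K_def U by (blast intro: t_span_eqI)
  qed
  moreover have "van B d" if "K l a d" for d
    using that U by (auto simp: van_def B_def K_def M.representation_zero subset_eq)
  ultimately show ?thesis by blast
qed

lemma K_diff: "K l a x \<Longrightarrow> K l a y \<Longrightarrow> K l a (x - y)"
  and K_scale: "K l a x \<Longrightarrow> K l a (sD c x)"
  by (auto simp: K_def)

lemma K_bracket: "K l a d \<Longrightarrow> K l b d' \<Longrightarrow> K l (a + b) (sD (\<phi> b d) d' - sD (\<phi> a d') d)"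
  unfolding K_def using t_comm[of a d b d'] by (metis t_0 diff_zero)

text \<open>Evaluating f on a bracket of annihilating elements gives
  \<open>\<phi> b d * f d' = \<phi> a d' * f d\<close>. If \<open>\<phi> b\<close> vanishes on
  \<open>K l a\<close>, taking d' = e makes f vanish there; otherwise a d with
  \<open>\<phi> b d \<noteq> 0\<close> makes f vanish where \<open>\<phi> a\<close> does on
  \<open>K l b\<close>.\<close>

lemma F_sum_cases:
  assumes f: "f \<in> lin_dual sD" "F l (a + b) f" and a: "K l b e" "\<phi> a e \<noteq> 0"
  shows "F l a (\<phi> b) \<and> F l a f \<or> (\<exists>d. K l a d \<and> \<phi> b d \<noteq> 0) \<and> (\<forall>d'. K l b d' \<longrightarrow> \<phi> a d' = 0 \<longrightarrow> f d' = 0)"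
proof -
  have *: "\<phi> b d * f d' = \<phi> a d' * f d" if "K l a d" "K l b d'" for d d'
    using K_bracket[OF that] f by (auto simp: F_def dual_diff dual_scale)
  show ?thesis
  proof (cases "F l a (\<phi> b)")
    case True
    then have "F l a f" using * a unfolding F_def by (metis mult_eq_0_iff mult_zero_left)
    with True show ?thesis by blast
  next
    case False
    then obtain d where "K l a d" "\<phi> b d \<noteq> 0" by (auto simp: F_def)
    with * show ?thesis by fastforce
  qed
qed

lemma F_independent_bound:
  assumes "J \<subseteq> lin_dual sD" "dual.independent J" "\<And>f. f \<in> J \<Longrightarrow> F l a f"
  shows "finite J" "card J \<le> N * N"
proof -
  obtain B where B: "small B" "card B \<le> N * N" "\<And>d. K l a d \<longleftrightarrow> van B d" using K_codim by metis
  have "J \<subseteq> dual.span B"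
    using assms B by (auto simp: F_def small_def intro!: dual_spanI)
  from dual.independent_span_bound[OF _ assms(2) this] B show "finite J" "card J \<le> N * N"
    by (auto simp: small_def)
qed

text \<open>Otherwise some \<open>\<phi> e\<close> lies in \<open>F l a\<close> for generic \<open>a\<close>, and adjoining generic \<open>\<phi> c\<close> gives
  independent sets of any size in the spaces \<open>F l a\<close>.\<close>

lemma ev_not_F:
  obtains e where "\<forall>\<^sub>F a in gen. \<not> F l a (\<phi> e)"
proof -
  \<comment> \<open>If every \<open>\<phi> e\<close> lay in \<open>F l c\<close> for generic c, then
    \<open>N * N + 1\<close> independent ones would lie in a common \<open>F l c\<close>.\<close>
  have "\<exists>e. \<exists>\<^sub>F c in gen. \<not> F l c (\<phi> e)"
  proof (rule ccontr)
    assume "\<nexists>e. \<exists>\<^sub>F c in gen. \<not> F l c (\<phi> e)"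
    then have ev: "\<forall>\<^sub>F c in gen. F l c (\<phi> e)" for e by (auto simp: frequently_def)
    have "\<exists>J. J \<subseteq> range \<phi> \<and> finite J \<and> dual.independent J \<and> card J = k" for k
    proof (induction k)
      case 0 show ?case by (intro exI[of _ "{}"]) (auto simp: dual.independent_empty)
    next
      case (Suc k)
      then obtain J where J: "J \<subseteq> range \<phi>" "finite J" "dual.independent J" "card J = k" by blast
      then have "small J" by (auto simp: small_def phi_dual)
      then obtain c where "\<phi> c \<notin> dual.span J" using gen_ex[OF ev_nz] nz_not_span by blast
      with J show ?case
        by (intro exI[of _ "insert (\<phi> c) J"]) (auto simp: dual.independent_insert dest: dual.span_base)
    qed
    then obtain J where J: "J \<subseteq> range \<phi>" "finite J" "dual.independent J" "card J = Suc (N * N)" by blast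
    then have "\<forall>\<^sub>F c in gen. \<forall>f\<in>J. F l c f" using ev by (intro eventually_ball_finite) auto
    then obtain c where "\<forall>f\<in>J. F l c f" using gen_ex by blast
    moreover have "J \<subseteq> lin_dual sD" using J phi_dual by blast
    ultimately show False using F_independent_bound[of J l c] J by auto
  qed
  then obtain e where e: "\<exists>\<^sub>F c in gen. \<not> F l c (\<phi> e)" by blast
  have "\<forall>\<^sub>F a in gen. \<not> F l a (\<phi> e)"
  proof (rule ccontr)
    assume "\<not> ?thesis"
    then have fr: "\<exists>\<^sub>F a in gen. F l a (\<phi> e)" by (simp add: frequently_def)
    \<comment> \<open>J always retains \<open>\<phi> e\<close>, which rules out one alternative of
      \<open>F_sum_cases\<close> at each enlargement.\<close>
    have "\<exists>J. J \<subseteq> range \<phi> \<and> finite J \<and> dual.independent J \<and> card J = Suc k \<and> \<phi> e \<in> J \<and>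
      (\<exists>\<^sub>F a in gen. \<forall>f\<in>J. F l a f)" for k
    proof (induction k)
      case 0
      from e obtain c where "\<not> F l c (\<phi> e)" by (rule frequentlyE)
      then have "\<phi> e \<noteq> 0" by (auto simp: F_def)
      then show ?case using fr by (intro exI[of _ "{\<phi> e}"]) (auto simp: dual.dependent_single)
    next
      case (Suc k)
      then obtain J where J: "J \<subseteq> range \<phi>" "finite J" "dual.independent J" "card J = Suc k" "\<phi> e \<in> J"
        "\<exists>\<^sub>F a in gen. \<forall>f\<in>J. F l a f" by blast
      then have sJ: "small J" by (auto simp: small_def phi_dual)
      from frequently_eventually_frequently[OF e ev_nz[OF sJ]]
      obtain c where c: "\<not> F l c (\<phi> e)" "nz J c" by (rule frequentlyE) auto
      from c(2) sJ have ci: "\<phi> c \<notin> dual.span J" by (auto dest: nz_not_span)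
      obtain B where B: "small B" "\<And>d. K l c d \<longleftrightarrow> van B d" using K_codim by metis
      from c B obtain d0 where d0: "K l c d0" "\<phi> e d0 \<noteq> 0" by (auto simp: F_def)
      have "\<forall>\<^sub>F a in gen. nz (insert (\<phi> c) (insert (\<phi> e) B)) a" using B by (intro ev_nz) simp
      then have "\<forall>\<^sub>F a in gen. (\<forall>f\<in>J. F l a f) \<longrightarrow> (\<forall>f\<in>insert (\<phi> c) J. F l (a - c) f)"
      proof eventually_elim
        case (elim a)
        then obtain d1 where d1: "K l c d1" "\<phi> c d1 = 0" "\<phi> e d1 = 0" "\<phi> a d1 = 1"
          using nz_val[OF elim, of 1] B by auto
        \<comment> \<open>The multiple of d1 makes \<open>\<phi> (a - c)\<close> vanish without
          changing \<open>\<phi> e\<close>. So d2 refutes the second alternative of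
          \<open>F_sum_cases\<close> for \<open>\<phi> e\<close>; hence \<open>\<phi> c\<close> lies
          in \<open>F l (a - c)\<close>, and this excludes the second alternative for all of
          J.\<close>
        define d2 where "d2 = d0 - sD (\<phi> (a - c) d0) d1"
        have d2: "K l c d2" "\<phi> (a - c) d2 = 0" "\<phi> e d2 \<noteq> 0"
          using d0 d1 by (auto simp: d2_def K_diff K_scale)
        show ?case
        proof
          assume F: "\<forall>f\<in>J. F l a f"
          have *: "F l (a - c) (\<phi> c) \<and> F l (a - c) f \<or> (\<exists>d. K l (a - c) d \<and> \<phi> c d \<noteq> 0) \<and>
            (\<forall>d'. K l c d' \<longrightarrow> \<phi> (a - c) d' = 0 \<longrightarrow> f d' = 0)" if "f \<in> J" for f
            using F that J d1 by (intro F_sum_cases[of _ _ _ _ d1]) (auto simp: phi_dual)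
          from *[OF J(5)] d2 have "F l (a - c) (\<phi> c)" by blast
          with * show "\<forall>f\<in>insert (\<phi> c) J. F l (a - c) f" by (auto simp: F_def)
        qed
      qed
      from frequently_mp[OF this J(6)] have "\<exists>\<^sub>F a in gen. \<forall>f\<in>insert (\<phi> c) J. F l a f"
        by (rule freq_shift)
      with J ci show ?case
        by (intro exI[of _ "insert (\<phi> c) J"]) (auto simp: dual.independent_insert dest: dual.span_base)
    qed
    from this[of "N * N"] obtain J where J: "J \<subseteq> range \<phi>" "dual.independent J" "card J = Suc (N * N)"
      "\<exists>\<^sub>F a in gen. \<forall>f\<in>J. F l a f" by blast
    from J(4) obtain a where "\<forall>f\<in>J. F l a f" by (rule frequentlyE)
    moreover have "J \<subseteq> lin_dual sD" using J phi_dual by blast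
    ultimately show False using F_independent_bound[of J l a] J by auto
  qed
  then show ?thesis by (rule that)
qed

definition kills :: "('d \<Rightarrow> complex) set \<Rightarrow> ('d \<Rightarrow> complex) \<Rightarrow> bool" where
  "kills B l \<longleftrightarrow> (\<forall>a d v. nz B a \<longrightarrow> van B d \<longrightarrow> \<phi> a d = 0 \<longrightarrow> v \<in> wt l \<longrightarrow> t a d v = 0)"

lemma killsD: "\<lbrakk>kills B l; nz B a; van B d; \<phi> a d = 0; v \<in> wt l\<rbrakk> \<Longrightarrow> t a d v = 0"
  by (simp add: kills_def)

text \<open>Write a = (a - e) + e with e from \<open>ev_not_F\<close>. For generic a the first
  alternative of \<open>F_sum_cases\<close> fails, so functionals in \<open>F l a\<close> vanish on
  the elements of \<open>K l e\<close> killed by \<open>\<phi> (a - e)\<close>. The conditions on d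
  thus come from the fixed degree e and from \<open>\<phi> a\<close> alone.\<close>

lemma generic_annihilator:
  obtains B where "small B" "kills B l"
proof -
  obtain e where e: "\<forall>\<^sub>F a in gen. \<not> F l a (\<phi> e)" by (rule ev_not_F)
  have "\<forall>\<^sub>F a in gen. \<not> F l (a - e) (\<phi> e)" using ev_shift[OF e, of "- e"] by simp
  then obtain B1 where B1: "small B1" "\<And>a. nz B1 a \<Longrightarrow> \<not> F l (a - e) (\<phi> e)"
    by (auto simp: eventually_gen)
  obtain Be where Be: "small Be" "\<And>d. K l e d \<longleftrightarrow> van Be d" using K_codim by metis
  show ?thesis
  proof (rule that[of "insert (\<phi> e) (B1 \<union> Be)"])
    show "small (insert (\<phi> e) (B1 \<union> Be))" using B1 Be by simp
    show "kills (insert (\<phi> e) (B1 \<union> Be)) l"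
      unfolding kills_def
    proof (intro allI impI)
      fix a d v assume a: "nz (insert (\<phi> e) (B1 \<union> Be)) a" and d: "van (insert (\<phi> e) (B1 \<union> Be)) d"
        and ad: "\<phi> a d = 0" and v: "v \<in> wt l"
      have nF: "\<not> F l (a - e) (\<phi> e)" using a B1 nz_mono by blast
      obtain d1 where d1: "K l e d1" "\<phi> (a - e) d1 \<noteq> 0"
        using a Be by (auto simp: nz_def)
      obtain Ba where Ba: "small Ba" "\<And>d. K l a d \<longleftrightarrow> van Ba d" using K_codim by metis
      have "f d = 0" if "f \<in> Ba" for f
      proof -
        have "f \<in> lin_dual sD" "F l (a - e + e) f" using that Ba by (auto simp: small_def F_def van_def)
        from F_sum_cases[OF this d1] nF have "\<forall>d'. K l e d' \<longrightarrow> \<phi> (a - e) d' = 0 \<longrightarrow> f d' = 0" by blast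
        then show ?thesis using d ad Be by auto
      qed
      then have "K l a d" using Ba by (auto simp: van_def)
      with v show "t a d v = 0" by (auto simp: K_def)
    qed
  qed
qed

end

section \<open>Transport of generic weight spaces and the maximal rank\<close>

locale nontrivial_witt_rep = bounded_witt_rep sD \<phi> sM t N
  for sD :: "complex \<Rightarrow> 'd \<Rightarrow> 'd::ab_group_add"
    and \<phi> :: "'g::ab_group_add \<Rightarrow> 'd \<Rightarrow> complex"
    and sM :: "complex \<Rightarrow> 'm \<Rightarrow> 'm::ab_group_add"
    and t :: "'g \<Rightarrow> 'd \<Rightarrow> 'm \<Rightarrow> 'm"
    and N :: nat +
  assumes nontrivial: "(\<And>a d. t a d v = 0) \<Longrightarrow> v = 0"
    and wt_nonzero: "\<exists>l. \<exists>v\<in>wt l. v \<noteq> 0"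
begin

text \<open>Since \<open>\<phi> (a - c) d1 = -1\<close>, the factor 1/2 gives
  \<open>\<phi> (a - c) d2 = \<phi> (a - c) d / 2\<close>, so the d1-terms of the bracket cancel. An
  arbitrary degree a is reached from a - c and c, which can both be generic.\<close>

lemma t_bracket:
  fixes d d1 :: 'd
  assumes "\<phi> a d1 = 0" "\<phi> c d1 = 1"
  defines "d2 \<equiv> d + sD (\<phi> (a - c) d / 2) d1"
  shows "t a d v = t (a - c) d1 (t c d2 v) - t c d2 (t (a - c) d1 v)"
proof -
  have "sD (\<phi> c d1) d2 - sD (\<phi> (a - c) d2) d1 = d"
    using assms(1,2) by (simp add: d2_def field_simps flip: D.scale_left_distrib)
  then show ?thesis
    by (simp only: t_comm diff_add_cancel)
qed

text \<open>For fixed a and generic c both c and a - c are generic, so \<open>t_bracket\<close>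
  writes \<open>t a d v\<close> in terms of zero vectors.\<close>

lemma generic_killed:
  assumes "\<forall>\<^sub>F c in gen. \<forall>d. t c d v = 0"
  shows "v = 0"
proof (rule nontrivial)
  fix a d
  have "\<forall>\<^sub>F c in gen. nz {\<phi> a} c \<and> (\<forall>d. t c d v = 0) \<and> (\<forall>d. t (a - c) d v = 0)"
    using assms ev_reflect[OF assms, of a] by (intro eventually_conj ev_nz) auto
  then obtain c where c: "nz {\<phi> a} c" "\<And>d. t c d v = 0" "\<And>d. t (a - c) d v = 0"
    using gen_ex by blast
  obtain d1 where "\<phi> a d1 = 0" "\<phi> c d1 = 1" using nz_val[OF c(1), of 1] by auto
  from t_bracket[OF this] c show "t a d v = 0" by simp
qed

definition H :: "('d \<Rightarrow> complex) \<Rightarrow> 'g \<Rightarrow> 'm set" where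
  "H l b = M.span {t b d v | d v. v \<in> wt l}"

lemma H_wt: "H l b \<subseteq> wt (\<lambda>x. l x + \<phi> b x)"
  unfolding H_def by (intro M.span_minimal subspace_wt) (auto intro: t_wt)

lemma t_mult:
  assumes "kills B l" "nz B a" "van B d" "\<phi> a d = 0" "\<phi> a d' = 0" "v \<in> wt l"
  shows "t a d (t b d' v) = sM (\<phi> b d) (t (a + b) d' v)"
  using assms(2-) killsD[OF assms(1-4,6)] by (simp add: t_comm'[of a d b d' v])

text \<open>Multiplication by t^(b - b0) is realised by \<open>t (b - b0) (e b)\<close>: as
  \<open>e b\<close> has value 1 on both b0 and b, \<open>\<phi> (b - b0)\<close> vanishes on it and
  \<open>t_mult\<close> applies with factor 1. The same \<open>e b\<close> in degree b0 - b gives a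
  left inverse, hence injectivity.\<close>

lemma H_shift:
  assumes B: "small B" "kills B l"
    and b0: "nz B b0"
  obtains \<tau> :: "'g \<Rightarrow> 'm \<Rightarrow> 'm"
  where "\<And>b x y. \<tau> b (x + y) = \<tau> b x + \<tau> b y" "\<And>b z x. \<tau> b (sM z x) = sM z (\<tau> b x)"
    "\<And>b q. \<lbrakk>nz (insert (\<phi> b0) B) b; q \<in> H l b0; \<tau> b q = 0\<rbrakk> \<Longrightarrow> q = 0"
    "\<And>b q. q \<in> H l b0 \<Longrightarrow> \<tau> b q \<in> wt (\<lambda>x. l x + \<phi> b x)"
    "\<And>a b d q. \<lbrakk>ind2 (insert (\<phi> b0) B) b a; van (insert (\<phi> b0) B) d; \<phi> a d = 0; q \<in> H l b0\<rbrakk>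
      \<Longrightarrow> t a d (\<tau> b q) = sM (\<phi> b d) (\<tau> (a + b) q)"
proof -
  let ?B = "insert (\<phi> b0) B"
  have ind: "ind2 B b0 b" if "nz ?B b" for b
    using B b0 that by (intro ind2I) auto
  define e where "e b = (SOME d. van B d \<and> \<phi> b0 d = 1 \<and> \<phi> b d = 1)" for b
  have e: "van B (e b)" "\<phi> b0 (e b) = 1" "\<phi> b (e b) = 1" if "nz ?B b" for b
    using someI_ex[OF ind2_val[OF ind[OF that], of 1 1]] by (auto simp: e_def)
  define \<tau> where "\<tau> b = t (b - b0) (e b)" for b
  have nzd: "nz B (b - b0)" "nz B (b0 - b)" if "nz ?B b" for b
  proof -
    from ind2_val[OF ind[OF that], of 0 1] obtain d where "van B d" "\<phi> b0 d = 0" "\<phi> b d = 1" by auto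
    then show "nz B (b - b0)" "nz B (b0 - b)" by (auto simp: nz_def intro!: exI[of _ d])
  qed
  have \<tau>_gen: "\<tau> b (t b0 d v) = t b d v" if "nz ?B b" "\<phi> b d = \<phi> b0 d" "v \<in> wt l" for b d v
    using t_mult[OF B(2) nzd(1)[OF that(1)] e(1)[OF that(1)], where d'=d and v=v and b=b0] e[OF that(1)] that
    by (simp add: \<tau>_def)
  \<comment> \<open>Altering d by an element covered by \<open>kills\<close> in degree b0 does not
    change \<open>t b0 d v\<close>; this freedom adjusts \<open>\<phi> b d\<close>, and in
    \<open>gen3\<close> also \<open>\<phi> a d\<close>.\<close>
  have gen2: "\<exists>d'. t b0 d' v = t b0 d v \<and> \<phi> b d' = \<phi> b0 d'" if "nz ?B b" "v \<in> wt l" for b d v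
  proof -
    from ind2_val[OF ind[OF that(1)], of 0 "\<phi> b d - \<phi> b0 d"]
    obtain d1 where "van B d1" "\<phi> b0 d1 = 0" "\<phi> b d1 = \<phi> b d - \<phi> b0 d" by blast
    then show ?thesis using killsD[OF B(2) b0 _ _ that(2), of d1]
      by (intro exI[of _ "d - d1"]) (auto simp: algebra_simps)
  qed
  have gen3: "\<exists>d'. t b0 d' v = t b0 d v \<and> \<phi> b d' = \<phi> b0 d' \<and> \<phi> a d' = 0"
    if "ind2 ?B b a" "v \<in> wt l" for a b d v
  proof -
    from ind2_val[OF that(1), of "\<phi> b d - \<phi> b0 d" "\<phi> a d"]
    obtain d1 where "van B d1" "\<phi> b0 d1 = 0" "\<phi> b d1 = \<phi> b d - \<phi> b0 d" "\<phi> a d1 = \<phi> a d" by auto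
    then show ?thesis using killsD[OF B(2) b0 _ _ that(2), of d1]
      by (intro exI[of _ "d - d1"]) (auto simp: algebra_simps)
  qed
  have lin: "\<tau> b (x + y) = \<tau> b x + \<tau> b y" "\<tau> b (sM z x) = sM z (\<tau> b x)" for b x y z
    by (simp_all add: \<tau>_def)
  have zero: "\<tau> b 0 = 0" for b by (simp add: \<tau>_def)
  show ?thesis
  proof (rule that[OF lin])
    show "q = 0" if "nz ?B b" "q \<in> H l b0" "\<tau> b q = 0" for b q
    proof -
      have "t (b0 - b) (e b) (\<tau> b q) = q"
        using that(2) unfolding H_def
      proof (induction rule: M.span_induct_alt)
        case base
        show ?case by (simp add: zero)
      next
        case (step c x y)
        then obtain d v where x: "x = t b0 d v" "v \<in> wt l" by blast
        from gen2[OF that(1) x(2), of d] x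
        obtain d' where d': "t b0 d' v = x" "\<phi> b d' = \<phi> b0 d'" by auto
        have "t (b0 - b) (e b) (t b d' v) = x"
          using t_mult[OF B(2) nzd(2)[OF that(1)] e(1)[OF that(1)], where d'=d' and v=v and b=b] e[OF that(1)] d' x
          by simp
        then have "t (b0 - b) (e b) (\<tau> b x) = x"
          using \<tau>_gen[OF that(1) d'(2) x(2)] d' by simp
        with step show ?case by (simp add: lin)
      qed
      with that(3) show "q = 0" by simp
    qed
    show "\<tau> b q \<in> wt (\<lambda>x. l x + \<phi> b x)" if "q \<in> H l b0" for b q
    proof -
      have "q \<in> wt (\<lambda>x. l x + \<phi> b0 x)" using H_wt that by blast
      from t_wt[OF this, of "b - b0" "e b"] show ?thesis by (simp add: \<tau>_def)
    qed
    show "t a d (\<tau> b q) = sM (\<phi> b d) (\<tau> (a + b) q)"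
      if A: "ind2 ?B b a" "van ?B d" "\<phi> a d = 0" "q \<in> H l b0" for a b d q
      using A(4) unfolding H_def
    proof (induction rule: M.span_induct_alt)
      case base
      show ?case by (simp add: zero)
    next
      case (step c x y)
      then obtain d1 v where x: "x = t b0 d1 v" "v \<in> wt l" by blast
      obtain d' where d': "t b0 d' v = x" "\<phi> b d' = \<phi> b0 d'" "\<phi> a d' = 0"
        using gen3[OF A(1) x(2), of d1] x by auto
      from ind2_val[OF A(1), of 1 1] obtain e' where "van ?B e'" "\<phi> b e' = 1" "\<phi> a e' = 1" by blast
      then have nz: "nz ?B b" "nz B a" "nz ?B (a + b)" by (auto intro!: nzI[of _ e'])
      have "\<tau> b x = t b d' v" "\<tau> (a + b) x = t (a + b) d' v"
        using \<tau>_gen[OF nz(1), of d' v] \<tau>_gen[OF nz(3), of d' v] d' x by auto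
      then have "t a d (\<tau> b x) = sM (\<phi> b d) (\<tau> (a + b) x)"
        using t_mult[OF B(2) nz(2), where d=d and d'=d' and v=v and b=b] A d' x by simp
      with step show ?case by (simp add: lin M.scale_right_distrib mult.commute)
    qed
  qed
qed

text \<open>If the generic dimension of \<open>H l b\<close> is maximal, then \<open>t\<^sup>a D\<close> cannot map the weight spaces of
  weight \<open>l + b\<close> outside the sections \<open>\<tau>\<close> built from \<open>l\<close>.\<close>

definition maxrank :: "nat \<Rightarrow> bool" where
  "maxrank k \<longleftrightarrow> (\<exists>l. \<exists>\<^sub>F b in gen. \<exists>I\<subseteq>H l b. finite I \<and> M.independent I \<and> card I = k)"

text \<open>Ranks are at most N because \<open>H l b\<close> lies in one weight space. Rank 1
  occurs, since otherwise a nonzero weight vector would be killed in all generic degrees.\<close>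

lemma maximal_rank: "\<exists>k>0. maxrank k \<and> \<not> maxrank (Suc k)"
proof -
  have bd: "k \<le> N" if "maxrank k" for k
  proof -
    obtain l b I where I: "I \<subseteq> H l b" "M.independent I" "card I = k"
      using \<open>maxrank k\<close> unfolding maxrank_def by (auto dest!: frequently_ex)
    obtain C where C: "finite C" "card C \<le> N" "wt (\<lambda>x. l x + \<phi> b x) \<subseteq> M.span C" using bounded by blast
    then have "I \<subseteq> M.span C" using I H_wt by blast
    from M.independent_span_bound[OF C(1) I(2) this] C I show ?thesis by simp
  qed
  have "maxrank 1"
  proof (rule ccontr)
    assume n: "\<not> maxrank 1"
    obtain l v where v: "v \<in> wt l" "v \<noteq> 0" using wt_nonzero by blast
    have "\<forall>\<^sub>F b in gen. \<not> (\<exists>I\<subseteq>H l b. finite I \<and> M.independent I \<and> card I = 1)"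
      using n by (simp add: maxrank_def frequently_def)
    then have "\<forall>\<^sub>F b in gen. \<forall>d. t b d v = 0"
    proof eventually_elim
      case (elim b)
      show ?case
      proof (intro allI, rule ccontr)
        fix d assume "t b d v \<noteq> 0"
        moreover have "t b d v \<in> H l b" unfolding H_def using v by (intro M.span_base) blast
        ultimately show False using elim by (auto dest!: spec[of _ "{t b d v}"] simp: M.dependent_single)
      qed
    qed
    with v generic_killed show False by blast
  qed
  show ?thesis
  proof (rule ccontr)
    assume "\<not> ?thesis"
    then have step: "maxrank (Suc k)" if "0 < k" "maxrank k" for k using that by blast
    have "maxrank (Suc k)" for k
      by (induction k) (use \<open>maxrank 1\<close> step in auto)
    from bd[OF this[of N]] show False by simp
  qed
qed

text \<open>Take \<Lambda> of maximal rank k, a degree b0 attaining it, Q =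
  \<open>H \<Lambda> b0\<close>, and transport. For generic a the k transported vectors lie in the
  space \<open>H\<close> of weight \<Lambda> + b and degree a; a \<open>t a d m\<close> outside
  their span would give that weight rank k + 1.\<close>

lemma generic_sections:
  obtains \<Lambda> B Q and \<tau> :: "'g \<Rightarrow> 'm \<Rightarrow> 'm"
  where "\<Lambda> \<in> lin_dual sD" "small B" "M.subspace Q" "\<exists>C. finite C \<and> Q \<subseteq> M.span C" "\<exists>q\<in>Q. q \<noteq> 0"
    "\<And>b x y. \<tau> b (x + y) = \<tau> b x + \<tau> b y" "\<And>b z x. \<tau> b (sM z x) = sM z (\<tau> b x)"
    "\<And>b q. \<lbrakk>nz B b; q \<in> Q; \<tau> b q = 0\<rbrakk> \<Longrightarrow> q = 0"
    "\<And>b q. q \<in> Q \<Longrightarrow> \<tau> b q \<in> wt (\<lambda>x. \<Lambda> x + \<phi> b x)"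
    "\<And>a b d q. \<lbrakk>ind2 B b a; van B d; \<phi> a d = 0; q \<in> Q\<rbrakk> \<Longrightarrow> t a d (\<tau> b q) = sM (\<phi> b d) (\<tau> (a + b) q)"
    "\<And>b. nz B b \<Longrightarrow> \<forall>\<^sub>F a in gen. \<forall>m\<in>wt (\<lambda>x. \<Lambda> x + \<phi> b x). \<forall>d. t a d m \<in> \<tau> (a + b) ` Q"
proof -
  obtain k where k: "k > 0" "maxrank k" "\<not> maxrank (Suc k)" using maximal_rank by blast
  obtain \<Lambda> where \<Lambda>: "\<exists>\<^sub>F b in gen. \<exists>I\<subseteq>H \<Lambda> b. finite I \<and> M.independent I \<and> card I = k"
    using k(2) by (auto simp: maxrank_def)
  obtain B where B: "small B" "kills B \<Lambda>"
    by (rule generic_annihilator)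
  from frequently_eventually_frequently[OF \<Lambda> ev_nz[OF B(1)]]
  obtain b0 I where b0: "nz B b0" and I: "I \<subseteq> H \<Lambda> b0" "finite I" "M.independent I" "card I = k"
    by (auto dest!: frequently_ex)
  from H_shift[OF B b0] obtain \<tau> :: "'g \<Rightarrow> 'm \<Rightarrow> 'm" where
    \<tau>: "\<And>b x y. \<tau> b (x + y) = \<tau> b x + \<tau> b y" "\<And>b z x. \<tau> b (sM z x) = sM z (\<tau> b x)"
    "\<And>b q. \<lbrakk>nz (insert (\<phi> b0) B) b; q \<in> H \<Lambda> b0; \<tau> b q = 0\<rbrakk> \<Longrightarrow> q = 0"
    "\<And>b q. q \<in> H \<Lambda> b0 \<Longrightarrow> \<tau> b q \<in> wt (\<lambda>x. \<Lambda> x + \<phi> b x)"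
    "\<And>a b d q. \<lbrakk>ind2 (insert (\<phi> b0) B) b a; van (insert (\<phi> b0) B) d; \<phi> a d = 0; q \<in> H \<Lambda> b0\<rbrakk>
      \<Longrightarrow> t a d (\<tau> b q) = sM (\<phi> b d) (\<tau> (a + b) q)" by blast
  let ?B = "insert (\<phi> b0) B" and ?Q = "H \<Lambda> b0"
  have sB: "small ?B" using B by simp
  have sub: "M.subspace ?Q" by (simp add: H_def)
  have lin: "Vector_Spaces.linear sM sM (\<tau> b)" for b
    by (simp add: Vector_Spaces.linear_iff M.vector_space_axioms \<tau>)
  interpret MM: vector_space_pair sM sM by unfold_locales
  have inj: "inj_on (\<tau> b) ?Q" if "nz ?B b" for b
    using MM.linear_inj_on_iff_eq_0[OF lin sub] \<tau>(3)[OF that] by blast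
  have spI: "M.span I \<subseteq> ?Q" using I sub by (intro M.span_minimal)
  show ?thesis
  proof (rule that[of \<Lambda> ?B ?Q \<tau>])
    show "\<exists>C. finite C \<and> ?Q \<subseteq> M.span C" using bounded H_wt by (meson order_trans)
    obtain x where x: "x \<in> I" using I k by fastforce
    then have "x \<noteq> 0" using I M.dependent_zero by blast
    with x I show "\<exists>q\<in>?Q. q \<noteq> 0" by blast
    show "\<Lambda> \<in> lin_dual sD"
    proof (rule ccontr)
      assume "\<Lambda> \<notin> lin_dual sD"
      then have "wt \<Lambda> \<subseteq> {0}" using wt_nonzero_dual by blast
      then have "?Q \<subseteq> {0}" unfolding H_def by (intro M.span_minimal) auto
      with \<open>x \<noteq> 0\<close> x I show False by blast
    qed
    fix b assume b: "nz ?B b"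
    let ?l = "\<lambda>x. \<Lambda> x + \<phi> b x"
    have "\<forall>\<^sub>F a in gen. \<not> (\<exists>I\<subseteq>H ?l a. finite I \<and> M.independent I \<and> card I = Suc k)"
      using k(3) by (auto simp: maxrank_def frequently_def)
    with ev_ind2[OF sB b]
    show "\<forall>\<^sub>F a in gen. \<forall>m\<in>wt ?l. \<forall>d. t a d m \<in> \<tau> (a + b) ` ?Q"
    proof eventually_elim
      case (elim a)
      from ind2_val[OF elim(1), of 1 0] obtain d where d: "van ?B d" "\<phi> b d = 1" "\<phi> a d = 0" by blast
      then have nz: "nz ?B (a + b)" by (auto intro!: nzI)
      have "M.independent (\<tau> (a + b) ` I)"
        using I inj_on_subset[OF inj[OF nz] spI]
        by (intro MM.linear_independent_injective_image[OF lin])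
      then have J: "finite (\<tau> (a + b) ` I)" "M.independent (\<tau> (a + b) ` I)" "card (\<tau> (a + b) ` I) = k"
        using I inj_on_subset[OF inj[OF nz]] by (auto simp: card_image)
      have J': "\<tau> (a + b) ` I \<subseteq> H ?l a"
      proof safe
        fix x assume "x \<in> I"
        then have x: "x \<in> ?Q" using I by blast
        have "t a d (\<tau> b x) = \<tau> (a + b) x" using \<tau>(5)[OF elim(1) d(1,3) x] d by simp
        moreover have "t a d (\<tau> b x) \<in> H ?l a"
          unfolding H_def using \<tau>(4)[OF x] by (intro M.span_base) blast
        ultimately show "\<tau> (a + b) x \<in> H ?l a" by simp
      qed
      show ?case
      proof (intro ballI allI)
        fix m d assume "m \<in> wt ?l"
        then have m: "t a d m \<in> H ?l a" unfolding H_def by (intro M.span_base) blast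
        have "t a d m \<in> M.span (\<tau> (a + b) ` I)"
        proof (rule ccontr)
          assume n: "t a d m \<notin> M.span (\<tau> (a + b) ` I)"
          then have "M.independent (insert (t a d m) (\<tau> (a + b) ` I))"
            using J by (intro M.independent_insertI)
          moreover have "t a d m \<notin> \<tau> (a + b) ` I" using n M.span_base by blast
          ultimately show False using elim(2) J J' m
            by (auto dest!: spec[of _ "insert (t a d m) (\<tau> (a + b) ` I)"])
        qed
        also have "M.span (\<tau> (a + b) ` I) = \<tau> (a + b) ` M.span I"
          by (rule MM.linear_span_image[OF lin])
        finally show "t a d m \<in> \<tau> (a + b) ` ?Q" using spI by blast
      qed
    qed
  qed (use \<tau> sB sub in blast)+
qed

end

subsection \<open>Expansion of weight vectors along generic directions\<close>

locale witt_sections = nontrivial_witt_rep sD \<phi> sM t N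
  for sD :: "complex \<Rightarrow> 'd \<Rightarrow> 'd::ab_group_add"
    and \<phi> :: "'g::ab_group_add \<Rightarrow> 'd \<Rightarrow> complex"
    and sM :: "complex \<Rightarrow> 'm \<Rightarrow> 'm::ab_group_add"
    and t :: "'g \<Rightarrow> 'd \<Rightarrow> 'm \<Rightarrow> 'm"
    and N :: nat +
  fixes \<Lambda> :: "'d \<Rightarrow> complex" and B :: "('d \<Rightarrow> complex) set" and Q :: "'m set" and \<tau> :: "'g \<Rightarrow> 'm \<Rightarrow> 'm"
  assumes weight_dual: "\<Lambda> \<in> lin_dual sD" and small_B: "small B" and subspace_Q: "M.subspace Q"
    and finite_Q: "\<exists>C. finite C \<and> Q \<subseteq> M.span C" and nonzero_Q: "\<exists>q\<in>Q. q \<noteq> 0"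
    and tau_add [simp]: "\<tau> b (x + y) = \<tau> b x + \<tau> b y"
    and tau_scale [simp]: "\<tau> b (sM z x) = sM z (\<tau> b x)"
    and tau_eq_0: "\<lbrakk>nz B b; q \<in> Q; \<tau> b q = 0\<rbrakk> \<Longrightarrow> q = 0"
    and tau_wt: "q \<in> Q \<Longrightarrow> \<tau> b q \<in> wt (\<lambda>x. \<Lambda> x + \<phi> b x)"
    and t_tau: "\<lbrakk>ind2 B b a; van B d; \<phi> a d = 0; q \<in> Q\<rbrakk> \<Longrightarrow> t a d (\<tau> b q) = sM (\<phi> b d) (\<tau> (a + b) q)"
    and t_in_tau: "nz B b \<Longrightarrow> \<forall>\<^sub>F a in gen. \<forall>m\<in>wt (\<lambda>x. \<Lambda> x + \<phi> b x). \<forall>d. t a d m \<in> \<tau> (a + b) ` Q"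
begin

lemma Q_closed [simp]:
  "x \<in> Q \<Longrightarrow> y \<in> Q \<Longrightarrow> x + y \<in> Q" "x \<in> Q \<Longrightarrow> y \<in> Q \<Longrightarrow> x - y \<in> Q" "x \<in> Q \<Longrightarrow> sM c x \<in> Q" "0 \<in> Q"
  using subspace_Q by (auto intro: M.subspace_add M.subspace_diff M.subspace_scale M.subspace_0)

lemma tau_0 [simp]: "\<tau> b 0 = 0"
  using tau_scale[of b 0 0] by simp

lemma tau_minus [simp]: "\<tau> b (- x) = - \<tau> b x"
  using tau_scale[of b "-1" x] by simp

lemma tau_diff [simp]: "\<tau> b (x - y) = \<tau> b x - \<tau> b y"
  using tau_add[of b x "- y"] by simp

lemma tau_inj: "nz B b \<Longrightarrow> x \<in> Q \<Longrightarrow> y \<in> Q \<Longrightarrow> \<tau> b x = \<tau> b y \<Longrightarrow> x = y"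
  using tau_eq_0[of b "x - y"] by simp

text \<open>A first-order jet of m: generically the coefficient of \<open>t a d m\<close> is affine
  in \<open>\<phi> a d\<close>, with s0 and s1 independent of a. In Gamma(V^c, l) the vector t^b has
  s0(d) = (b + l)(d) and s1 = c.\<close>

definition expansion :: "'g \<Rightarrow> 'm \<Rightarrow> ('d \<Rightarrow> 'm) \<Rightarrow> 'm \<Rightarrow> bool" where
  "expansion b m s0 s1 \<longleftrightarrow>
    (\<forall>x y. s0 (x + y) = s0 x + s0 y) \<and> (\<forall>c x. s0 (sD c x) = sM c (s0 x)) \<and> (\<forall>d. s0 d \<in> Q) \<and> s1 \<in> Q \<and>
    (\<forall>\<^sub>F a in gen. \<forall>d. t a d m = \<tau> (a + b) (s0 d + sM (\<phi> a d) s1))"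

lemma expansion_ev: "expansion b m s0 s1 \<Longrightarrow> \<forall>\<^sub>F a in gen. \<forall>d. t a d m = \<tau> (a + b) (s0 d + sM (\<phi> a d) s1)"
  and expansion_Q: "expansion b m s0 s1 \<Longrightarrow> s0 d \<in> Q" "expansion b m s0 s1 \<Longrightarrow> s1 \<in> Q"
  by (simp_all add: expansion_def)

text \<open>The coefficient \<open>s a d\<close> depends on a, for generic a, only through
  \<open>\<phi> a d\<close>; combined with linearity in d this makes it affine in that
  value.\<close>

lemma expansion_ex:
  assumes "nz B b" "m \<in> wt (\<lambda>x. \<Lambda> x + \<phi> b x)"
  shows "\<exists>s0 s1. expansion b m s0 s1"
proof -
  from t_in_tau[OF assms(1)] obtain B2 where
    B2: "small B2" "\<And>a d. nz B2 a \<Longrightarrow> t a d m \<in> \<tau> (a + b) ` Q"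
    using assms(2) by (auto simp: eventually_gen)
  obtain B' where B': "small B'" "kills B' (\<lambda>x. \<Lambda> x + \<phi> b x)" by (rule generic_annihilator)
  define B3 where "B3 = insert (\<phi> b) (B \<union> B2 \<union> B')"
  have sB3: "small B3" using small_B B2 B' by (simp add: B3_def)
  have van3: "van B3 d \<Longrightarrow> van B d \<and> van B' d \<and> \<phi> b d = 0" for d by (simp add: B3_def)
  define s where "s a d = (SOME q. q \<in> Q \<and> t a d m = \<tau> (a + b) q)" for a d
  have s: "s a d \<in> Q" "t a d m = \<tau> (a + b) (s a d)" if "nz B3 a" for a d
  proof -
    have "nz B2 a" using that by (rule nz_mono) (auto simp: B3_def)
    then have "\<exists>q. q \<in> Q \<and> t a d m = \<tau> (a + b) q" using B2 by blast
    from someI_ex[OF this] show "s a d \<in> Q" "t a d m = \<tau> (a + b) (s a d)" by (auto simp: s_def)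
  qed
  have nzab: "nz B (a + b)" if "nz B3 a" for a
    using that by (auto simp: nz_def B3_def)
  have s_add: "s a (x + y) = s a x + s a y" if "nz B3 a" for a x y
  proof (rule tau_inj[OF nzab[OF that]])
    have "\<tau> (a + b) (s a (x + y)) = t a (x + y) m" using s(2)[OF that] by metis
    also have "\<dots> = \<tau> (a + b) (s a x) + \<tau> (a + b) (s a y)" by (simp only: t_add_d s(2)[OF that])
    finally show "\<tau> (a + b) (s a (x + y)) = \<tau> (a + b) (s a x + s a y)" by simp
  qed (use s[OF that] in auto)
  have s_scale: "s a (sD c x) = sM c (s a x)" if "nz B3 a" for a c x
  proof (rule tau_inj[OF nzab[OF that]])
    have "\<tau> (a + b) (s a (sD c x)) = t a (sD c x) m" using s(2)[OF that] by metis
    also have "\<dots> = sM c (\<tau> (a + b) (s a x))" by (simp only: t_scale_d s(2)[OF that])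
    finally show "\<tau> (a + b) (s a (sD c x)) = \<tau> (a + b) (sM c (s a x))" by simp
  qed (use s[OF that] in auto)
  have s_diff: "s a (x - y) = s a x - s a y" if "nz B3 a" for a x y
    using s_add[OF that, of "x - y" y] by simp
  \<comment> \<open>With c = a' - a, the element \<open>t c e\<close> kills m, so commuting it past
    \<open>t a d\<close> turns \<open>t a d m\<close> into \<open>t a' d m\<close>; on sections it
    acts as the shift from a + b to a' + b.\<close>
  have s_eq: "s a d = s a' d" if ind: "ind2 B3 a a'" and eq: "\<phi> a d = \<phi> a' d" for a a' d
  proof -
    define c where "c = a' - a"
    from ind2_val[OF ind, of 1 1] obtain e where e: "van B3 e" "\<phi> a e = 1" "\<phi> a' e = 1" by blast
    have nz: "nz B3 a" "nz B3 a'" using e by (auto intro!: nzI)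
    from ind2_val[OF ind, of 0 1] have "nz B' c" using van3 by (auto simp: c_def intro!: nzI)
    from killsD[OF B'(2) this, of e m] have "t c e m = 0" using e van3 assms by (simp add: c_def)
    then have "t c e (t a d m) = t a' d m"
      using e eq by (subst t_comm') (simp add: c_def)
    moreover have "ind2 B (a + b) c"
      unfolding ind2_def
    proof (intro allI)
      fix x y
      from ind2_val[OF ind, of x "x + y"] obtain d where "van B3 d" "\<phi> a d = x" "\<phi> a' d = x + y" by blast
      then show "\<exists>d. van B d \<and> \<phi> (a + b) d = x \<and> \<phi> c d = y"
        using van3 by (intro exI[of _ d]) (auto simp: c_def)
    qed
    from t_tau[OF this, of e "s a d"] have "t c e (\<tau> (a + b) (s a d)) = \<tau> (a' + b) (s a d)"
      using e van3[OF e(1)] s(1)[OF nz(1), of d] by (simp add: c_def)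
    ultimately have "\<tau> (a' + b) (s a d) = \<tau> (a' + b) (s a' d)"
      using s(2)[OF nz(1), of d] s(2)[OF nz(2), of d] by metis
    then show ?thesis
      using s(1)[OF nz(1)] s(1)[OF nz(2)] by (rule tau_inj[OF nzab[OF nz(2)], rotated 2])
  qed
  obtain a1 where a1: "nz B3 a1" using gen_ex[OF ev_nz[OF sB3]] by blast
  obtain a2 where a2: "ind2 B3 a1 a2" using gen_ex[OF ev_ind2[OF sB3 a1]] by blast
  \<comment> \<open>The values of e on a1 and a2 differ by 1, so y is the increment of the
    coefficient per unit of \<open>\<phi> a d\<close>; it becomes s1. Fixing a second point a2 makes
    y independent of a.\<close>
  from ind2_val[OF a2, of "-1" 0] obtain e where e: "\<phi> a1 e = -1" "\<phi> a2 e = 0" by blast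
  from ind2_val[OF a2, of 0 1] have nz2: "nz B3 a2" by (auto intro!: nzI)
  define y where "y = s a2 e - s a1 e"
  have main: "s a d = (s a1 d - sM (\<phi> a1 d) y) + sM (\<phi> a d) y" and nza: "nz B3 a" if ind: "ind3 B3 a1 a2 a" for a d
  proof -
    from ind3_val[OF ind, of 0 0 1] obtain d3 where d3: "van B3 d3" "\<phi> a1 d3 = 0" "\<phi> a2 d3 = 0" "\<phi> a d3 = 1"
      by blast
    then show nza: "nz B3 a" by (auto intro!: nzI)
    have ind1: "ind2 B3 a1 a" and ind2: "ind2 B3 a2 a"
      unfolding ind2_def using ind3_val[OF ind] by meson+
    \<comment> \<open>Subtracting a multiple of d3 makes \<open>\<phi> a\<close> vanish and keeps
      the values on a1 and a2; so \<open>s_eq\<close> replaces a by a2 on d2 and then identifies the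
      increment with y.\<close>
    define d2 where "d2 = e - sD (\<phi> a e) d3"
    have d2: "\<phi> a1 d2 = -1" "\<phi> a2 d2 = 0" "\<phi> a d2 = 0" using e d3 by (auto simp: d2_def)
    define k where "k = \<phi> a d - \<phi> a1 d"
    have "s a1 (d - sD k d2) = s a (d - sD k d2)" by (rule s_eq[OF ind1]) (simp add: d2 k_def)
    then have 1: "s a d = s a1 d + sM k (s a d2 - s a1 d2)"
      by (simp add: s_diff s_scale nza a1 algebra_simps)
    have 2: "s a2 d2 = s a d2" by (rule s_eq[OF ind2]) (simp add: d2)
    have "s a1 (d2 - e) = s a2 (d2 - e)" by (rule s_eq[OF a2]) (simp add: d2 e)
    then have "s a2 d2 - s a1 d2 = y" by (simp add: s_diff nz2 a1 y_def algebra_simps)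
    with 1 2 show "s a d = (s a1 d - sM (\<phi> a1 d) y) + sM (\<phi> a d) y" by (simp add: k_def algebra_simps)
  qed
  have "\<forall>\<^sub>F a in gen. \<forall>d. t a d m = \<tau> (a + b) ((s a1 d - sM (\<phi> a1 d) y) + sM (\<phi> a d) y)"
    using ev_ind3[OF sB3 a2] by eventually_elim (metis main nza s(2))
  moreover have "s a1 d \<in> Q" "y \<in> Q" for d using s[OF a1] s[OF nz2] by (auto simp: y_def)
  ultimately have "expansion b m (\<lambda>d. s a1 d - sM (\<phi> a1 d) y) y"
    by (simp add: expansion_def s_add[OF a1] s_scale[OF a1] algebra_simps)
  then show ?thesis by blast
qed

section \<open>Uniqueness and propagation of expansions\<close>

lemma expansion_unique:
  assumes "expansion b m s0 s1" "expansion b m s0' s1'"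
  shows "s0 = s0'" "s1 = s1'"
proof -
  have "\<forall>\<^sub>F a in gen. \<forall>d. s0 d + sM (\<phi> a d) s1 = s0' d + sM (\<phi> a d) s1'"
    using assms[THEN expansion_ev]
      ev_shift[OF ev_nz[OF small_B], of b]
  proof eventually_elim
    case (elim a)
    show ?case
    proof
      fix d
      show "s0 d + sM (\<phi> a d) s1 = s0' d + sM (\<phi> a d) s1'"
      proof (rule tau_inj[OF elim(3)])
        show "\<tau> (a + b) (s0 d + sM (\<phi> a d) s1) = \<tau> (a + b) (s0' d + sM (\<phi> a d) s1')"
          using elim(1,2) by metis
      qed (use expansion_Q assms in auto)
    qed
  qed
  then have ev: "\<forall>\<^sub>F a in gen. \<forall>d. s0 d - s0' d = sM (\<phi> a d) (s1' - s1)"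
    by eventually_elim (simp add: algebra_simps)
  then obtain a where a: "\<And>d. s0 d - s0' d = sM (\<phi> a d) (s1' - s1)" using gen_ex by blast
  have "\<forall>\<^sub>F c in gen. nz {\<phi> a} c" by (intro ev_nz) simp
  with ev have "\<forall>\<^sub>F c in gen. nz {\<phi> a} c \<and> (\<forall>d. s0 d - s0' d = sM (\<phi> c d) (s1' - s1))"
    by eventually_elim simp
  then obtain c where c: "nz {\<phi> a} c" "\<And>d. s0 d - s0' d = sM (\<phi> c d) (s1' - s1)" using gen_ex by blast
  \<comment> \<open>Values 0 and 1 at two generic degrees on the same d separate the constant from
    the linear part.\<close>
  obtain d where "\<phi> a d = 0" "\<phi> c d = 1" using nz_val[OF c(1), of 1] by auto
  with a[of d] c(2)[of d] show 1: "s1 = s1'" by simp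
  show "s0 = s0'" using a 1 by (intro ext) simp
qed

lemma expansion_add:
  assumes "expansion b m s0 s1" "expansion b m' s0' s1'"
  shows "expansion b (m + m') (\<lambda>d. s0 d + s0' d) (s1 + s1')"
proof -
  have "\<forall>\<^sub>F a in gen. \<forall>d. t a d (m + m') = \<tau> (a + b) (s0 d + s0' d + sM (\<phi> a d) (s1 + s1'))"
    using assms[THEN expansion_ev]
    by eventually_elim (simp add: algebra_simps)
  with assms show ?thesis by (auto simp: expansion_def algebra_simps)
qed

lemma expansion_scale:
  assumes "expansion b m s0 s1"
  shows "expansion b (sM z m) (\<lambda>d. sM z (s0 d)) (sM z s1)"
proof -
  have "\<forall>\<^sub>F a in gen. \<forall>d. t a d (sM z m) = \<tau> (a + b) (sM z (s0 d) + sM (\<phi> a d) (sM z s1))"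
    using assms[THEN expansion_ev]
    by eventually_elim (simp add: algebra_simps)
  with assms show ?thesis by (auto simp: expansion_def algebra_simps)
qed

lemma expansion_eqI:
  assumes "expansion b m s0 s1" "expansion b m' s0 s1"
  shows "m = m'"
proof -
  have "\<forall>\<^sub>F a in gen. \<forall>d. t a d (m - m') = 0"
    using assms[THEN expansion_ev]
    by eventually_elim simp
  from generic_killed[OF this] show ?thesis by simp
qed

text \<open>Apply \<open>[t\<^sup>a d, t\<^sup>a\<^sup>' d']\<close> to \<open>m\<close> and note that \<open>t\<^sup>a d\<close> acts on the sections \<open>\<tau>\<close> by a scalar.\<close>

lemma expansion_step:
  assumes m: "expansion b m s0 s1"
  shows "\<forall>\<^sub>F a in gen. \<forall>d. van B d \<longrightarrow> \<phi> a d = 0 \<longrightarrow>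
    expansion (a + b) (\<tau> (a + b) (s0 d)) (\<lambda>d'. sM (\<phi> b d) (s0 d') + sM (\<phi> a d') (s0 d)) (sM (\<phi> b d) s1)"
proof -
  have ev: "\<forall>\<^sub>F a in gen. \<forall>d. t a d m = \<tau> (a + b) (s0 d + sM (\<phi> a d) s1)"
    and s: "\<And>x y. s0 (x + y) = s0 x + s0 y" "\<And>c x. s0 (sD c x) = sM c (s0 x)" "\<And>d. s0 d \<in> Q" "s1 \<in> Q"
    using m by (auto simp: expansion_def)
  show ?thesis using ev ev_nz[OF small_B]
  proof eventually_elim
    case (elim a)
    show ?case
    proof (intro allI impI)
      fix d assume d: "van B d" "\<phi> a d = 0"
      have a: "t a d m = \<tau> (a + b) (s0 d)" using elim(1) d by simp
      have "\<forall>\<^sub>F a' in gen. \<forall>d'. t a' d' (\<tau> (a + b) (s0 d)) =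
        \<tau> (a' + (a + b)) (sM (\<phi> b d) (s0 d') + sM (\<phi> a d') (s0 d) + sM (\<phi> a' d') (sM (\<phi> b d) s1))"
        using ev ev_shift[OF ev, of a] ev_shift[OF ev_ind2[OF small_B elim(2)], of b]
      proof eventually_elim
        case (elim a')
        have ind: "ind2 B (a' + b) a" using elim(3) unfolding ind2_def by meson
        show ?case
        proof
          fix d'
          have "t a' d' (\<tau> (a + b) (s0 d)) = t a d (t a' d' m) + sM (\<phi> a d') (t (a' + a) d m) - sM (\<phi> a' d) (t (a' + a) d' m)"
            by (simp add: t_comm'[of a' d' a d m] flip: a)
          also have "t a d (t a' d' m) = sM (\<phi> (a' + b) d) (\<tau> (a + (a' + b)) (s0 d' + sM (\<phi> a' d') s1))"
            using elim(1) s by (simp add: t_tau[OF ind d] del: tau_add tau_scale phi_simps)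
          also have "t (a' + a) d m = \<tau> (a' + a + b) (s0 d + sM (\<phi> (a' + a) d) s1)"
            using elim(2) by blast
          also have "t (a' + a) d' m = \<tau> (a' + a + b) (s0 d' + sM (\<phi> (a' + a) d') s1)"
            using elim(2) by blast
          finally show "t a' d' (\<tau> (a + b) (s0 d)) =
            \<tau> (a' + (a + b)) (sM (\<phi> b d) (s0 d') + sM (\<phi> a d') (s0 d) + sM (\<phi> a' d') (sM (\<phi> b d) s1))"
            using d by (simp add: algebra_simps)
        qed
      qed
      then show "expansion (a + b) (\<tau> (a + b) (s0 d)) (\<lambda>d'. sM (\<phi> b d) (s0 d') + sM (\<phi> a d') (s0 d)) (sM (\<phi> b d) s1)"
        using s by (simp add: expansion_def algebra_simps)
    qed
  qed
qed

text \<open>For d with \<open>\<phi> b d = 1\<close> and \<open>\<phi> a d = 0\<close>, comparing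
  \<open>t_tau\<close> with the expansion forces \<open>g d = 0\<close>. Then
  \<open>expansion_step\<close> for this d reproduces g and s1 at a + b.\<close>

lemma expansion_tau_shift:
  assumes "nz B b" "q \<in> Q" "expansion b (\<tau> b q) (\<lambda>d. sM (\<phi> b d) q + g d) s1"
  shows "\<forall>\<^sub>F a in gen. expansion (a + b) (\<tau> (a + b) q) (\<lambda>d. sM (\<phi> (a + b) d) q + g d) s1"
  using expansion_step[OF assms(3)]
    assms(3)[THEN expansion_ev]
    ev_ind2[OF small_B assms(1)]
proof eventually_elim
  case (elim a)
  from ind2_val[OF elim(3), of 1 0] obtain d where d: "van B d" "\<phi> b d = 1" "\<phi> a d = 0" by blast
  have nz: "nz B (a + b)" using d by (auto intro!: nzI)
  have "\<tau> (a + b) q = \<tau> (a + b) (q + g d)"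
    using t_tau[OF elim(3) d(1,3) assms(2)] elim(2) d by simp
  moreover have "g d \<in> Q"
    using Q_closed(2)[OF expansion_Q(1)[OF assms(3), of d] assms(2)] d by simp
  ultimately have "g d = 0" using tau_eq_0[OF nz, of "g d"] by simp
  with elim(1)[rule_format, OF d(1,3)] d show ?case by (simp add: algebra_simps)
qed

text \<open>The remainders g and s survive generic shifts, and shifts from any two base points reach
  a common c, where \<open>expansion_unique\<close> compares them. So they depend on q
  alone.\<close>

lemma expansion_tau:
  obtains \<gamma> C where "\<And>q b. \<lbrakk>q \<in> Q; nz B b\<rbrakk> \<Longrightarrow> expansion b (\<tau> b q) (\<lambda>d. sM (\<phi> b d) q + \<gamma> q d) (C q)"
proof -
  have "\<exists>g s. \<forall>b. nz B b \<longrightarrow> expansion b (\<tau> b q) (\<lambda>d. sM (\<phi> b d) q + g d) s" if q: "q \<in> Q" for q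
  proof -
    have ex: "\<exists>g s. expansion b (\<tau> b q) (\<lambda>d. sM (\<phi> b d) q + g d) s" if "nz B b" for b
    proof -
      from expansion_ex[OF that tau_wt[OF q]] obtain s0 s1 where "expansion b (\<tau> b q) s0 s1" by blast
      then show ?thesis by (intro exI[of _ "\<lambda>d. s0 d - sM (\<phi> b d) q"] exI[of _ s1]) simp
    qed
    have ev: "\<forall>\<^sub>F c in gen. expansion c (\<tau> c q) (\<lambda>d. sM (\<phi> c d) q + g d) s"
      if "nz B b" "expansion b (\<tau> b q) (\<lambda>d. sM (\<phi> b d) q + g d) s" for b g s
      using ev_shift[OF expansion_tau_shift[OF that(1) q that(2)], of "- b"] by simp
    obtain b1 where b1: "nz B b1" using gen_ex[OF ev_nz[OF small_B]] by blast
    obtain g s where g: "expansion b1 (\<tau> b1 q) (\<lambda>d. sM (\<phi> b1 d) q + g d) s" using ex[OF b1] by blast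
    have "expansion b (\<tau> b q) (\<lambda>d. sM (\<phi> b d) q + g d) s" if b: "nz B b" for b
    proof -
      obtain g' s' where g': "expansion b (\<tau> b q) (\<lambda>d. sM (\<phi> b d) q + g' d) s'" using ex[OF b] by blast
      from eventually_conj[OF ev[OF b1 g] ev[OF b g']] gen_ex obtain c where
        c: "expansion c (\<tau> c q) (\<lambda>d. sM (\<phi> c d) q + g d) s" "expansion c (\<tau> c q) (\<lambda>d. sM (\<phi> c d) q + g' d) s'"
        by blast
      from expansion_unique[OF c] have "g = g'" "s = s'" by (auto simp: fun_eq_iff)
      with g' show ?thesis by simp
    qed
    then show ?thesis by blast
  qed
  then show ?thesis using that by metis
qed

end

subsection \<open>Eigenvectors\<close>

text \<open>Take a nonzero polynomial p of least degree with p(f) w = 0 for some nonzero w in V, and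
  split off a root \<kappa>. The cofactor r has smaller degree, so r(f) w is nonzero, and f scales
  it by \<kappa>. Linearity is asked on V only, as the operator C is controlled only on Q.\<close>

lemma eigenvector_exists:
  fixes s :: "complex \<Rightarrow> 'v \<Rightarrow> 'v::ab_group_add"
  assumes vs: "vector_space s" and sub: "module.subspace s V"
    and fin: "finite S" "V \<subseteq> module.span s S" and nonzero: "w0 \<in> V" "w0 \<noteq> 0"
    and f_V: "\<And>x. x \<in> V \<Longrightarrow> f x \<in> V"
    and f_add: "\<And>x y. x \<in> V \<Longrightarrow> y \<in> V \<Longrightarrow> f (x + y) = f x + f y"
    and f_scale: "\<And>c x. x \<in> V \<Longrightarrow> f (s c x) = s c (f x)"
  shows "\<exists>w\<in>V. w \<noteq> 0 \<and> (\<exists>\<kappa>. f w = s \<kappa> w)"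
proof -
  interpret V: vector_space s by fact
  have pow: "(f ^^ i) x \<in> V" if "x \<in> V" for i x by (induction i) (use that f_V in auto)
  have f0: "f 0 = 0" using f_scale[of w0 0] nonzero by simp
  have sum_V: "(\<Sum>i\<in>I. s (g i) ((f ^^ i) x)) \<in> V" if "x \<in> V" for I g x
    using sub pow[OF that] by (intro V.subspace_sum V.subspace_scale)
  have f_sum: "f (\<Sum>i\<in>I. s (g i) ((f ^^ i) x)) = (\<Sum>i\<in>I. s (g i) ((f ^^ Suc i) x))"
    if "finite I" "x \<in> V" for I g x
    using that(1)
  proof induction
    case (insert i I)
    then show ?case using pow[OF that(2)] sum_V[OF that(2)] sub
      by (simp add: f_add f_scale V.subspace_scale)
  qed (simp add: f0)
  define ap where "ap p x = (\<Sum>i\<le>degree p. s (coeff p i) ((f ^^ i) x))" for p :: "complex poly" and x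
  have ap_le: "ap p x = (\<Sum>i\<le>n. s (coeff p i) ((f ^^ i) x))" if "degree p \<le> n" for p n x
    unfolding ap_def using that by (intro sum.mono_neutral_left) (auto simp: coeff_eq_0)
  have ap_factor: "ap ([:- \<kappa>, 1:] * r) x = f (ap r x) - s \<kappa> (ap r x)" if "x \<in> V" for \<kappa> r x
  proof -
    let ?n = "degree r"
    have "degree ([:- \<kappa>, 1:] * r) \<le> Suc ?n"
      using degree_mult_le[of "[:- \<kappa>, 1:]" r] by simp
    then have "ap ([:- \<kappa>, 1:] * r) x = (\<Sum>i\<le>Suc ?n. s (coeff ([:- \<kappa>, 1:] * r) i) ((f ^^ i) x))"
      by (rule ap_le)
    also have "\<dots> = (\<Sum>i\<le>Suc ?n. s (coeff (pCons 0 r) i) ((f ^^ i) x)) - s \<kappa> (\<Sum>i\<le>Suc ?n. s (coeff r i) ((f ^^ i) x))"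
      by (simp add: V.scale_sum_right V.scale_left_diff_distrib sum_subtractf
          del: sum.atMost_Suc coeff_pCons funpow.simps)
    also have "(\<Sum>i\<le>Suc ?n. s (coeff (pCons 0 r) i) ((f ^^ i) x)) = f (ap r x)"
      by (simp add: sum.atMost_Suc_shift ap_def f_sum that del: sum.atMost_Suc)
    also have "(\<Sum>i\<le>Suc ?n. s (coeff r i) ((f ^^ i) x)) = ap r x"
      by (rule ap_le[symmetric]) simp
    finally show ?thesis .
  qed
  have "\<exists>g n. (\<exists>i\<le>n. g i \<noteq> 0) \<and> (\<Sum>i\<le>n. s (g i) ((f ^^ i) w0)) = 0"
  proof -
    let ?n = "card S" and ?h = "\<lambda>i. (f ^^ i) w0"
    show ?thesis
    \<comment> \<open>Repeated powers are treated apart: dependence of the image set would not see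
      the repetition, which is itself a relation.\<close>
    proof (cases "inj_on ?h {..?n}")
      case True
      have "?h ` {..?n} \<subseteq> V.span S" using pow[OF nonzero(1)] fin by blast
      then have "\<not> V.independent (?h ` {..?n})"
        using V.independent_span_bound[OF fin(1), of "?h ` {..?n}"] card_image[OF True] by auto
      then obtain u where u: "\<exists>v\<in>?h ` {..?n}. u v \<noteq> 0" "(\<Sum>v\<in>?h ` {..?n}. s (u v) v) = 0"
        by (auto simp: V.dependent_finite)
      then show ?thesis
        by (intro exI[of _ "\<lambda>i. u (?h i)"] exI[of _ ?n]) (auto simp: sum.reindex[OF True])
    next
      case False
      then obtain i j where ij: "i \<le> ?n" "j \<le> ?n" "i \<noteq> j" "?h i = ?h j" by (auto simp: inj_on_def)
      define g where "g k = (if k = i then 1 else if k = j then -1 else 0 :: complex)" for k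
      have "(\<Sum>k\<le>?n. s (g k) (?h k)) = (\<Sum>k\<in>{i, j}. s (g k) (?h k))"
        using ij by (intro sum.mono_neutral_right) (auto simp: g_def)
      also have "\<dots> = 0" using ij by (simp add: g_def)
      finally show ?thesis using ij by (intro exI[of _ g] exI[of _ ?n]) (auto simp: g_def)
    qed
  qed
  then obtain g n where g: "\<exists>i\<le>n. g i \<noteq> 0" "(\<Sum>i\<le>n. s (g i) ((f ^^ i) w0)) = 0" by blast
  define p0 where "p0 = (\<Sum>i\<le>n. monom (g i) i)"
  have coeff_p0: "coeff p0 i = g i" if "i \<le> n" for i
    using that by (simp add: p0_def coeff_sum)
  have "degree p0 \<le> n" unfolding p0_def
    by (intro degree_sum_le) (auto intro: order_trans[OF degree_monom_le])
  then have "ap p0 w0 = 0" using g(2) coeff_p0 by (subst ap_le) auto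
  moreover have "p0 \<noteq> 0" using g(1) coeff_p0 by fastforce
  ultimately have "\<exists>p w. p \<noteq> 0 \<and> w \<in> V \<and> w \<noteq> 0 \<and> ap p w = 0" using nonzero by blast
  then obtain p where p: "\<exists>w. p \<noteq> 0 \<and> w \<in> V \<and> w \<noteq> 0 \<and> ap p w = 0"
    and min: "\<And>p'. \<exists>w. p' \<noteq> 0 \<and> w \<in> V \<and> w \<noteq> 0 \<and> ap p' w = 0 \<Longrightarrow> degree p \<le> degree p'"
    using ex_has_least_nat[of "\<lambda>p. \<exists>w. p \<noteq> 0 \<and> w \<in> V \<and> w \<noteq> 0 \<and> ap p w = 0" _ degree] by blast
  then obtain w where w: "w \<in> V" "w \<noteq> 0" "ap p w = 0" "p \<noteq> 0" by blast
  have "degree p \<noteq> 0"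
  proof
    assume "degree p = 0"
    then obtain c where "p = [:c:]" by (rule degree_eq_zeroE)
    with w show False by (simp add: ap_def)
  qed
  then have "\<not> constant (poly p)" by (simp add: constant_degree)
  then obtain \<kappa> where "poly p \<kappa> = 0" using fundamental_theorem_of_algebra by blast
  then obtain r where r: "p = [:- \<kappa>, 1:] * r" by (auto simp: poly_eq_0_iff_dvd)
  with w have "r \<noteq> 0" by auto
  then have "degree p = Suc (degree r)" unfolding r by (subst degree_mult_eq) auto
  with min[of r] \<open>r \<noteq> 0\<close> w have "ap r w \<noteq> 0" by auto
  moreover have "ap r w \<in> V" unfolding ap_def by (rule sum_V[OF w(1)])
  moreover have "f (ap r w) = s \<kappa> (ap r w)" using w(3) ap_factor[OF w(1)] by (simp add: r)
  ultimately show ?thesis by blast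
qed

subsection \<open>The action on generic weight spaces\<close>

context witt_sections
begin

context
  fixes \<gamma> :: "'m \<Rightarrow> 'd \<Rightarrow> 'm" and C :: "'m \<Rightarrow> 'm"
  assumes jet: "\<And>q b. \<lbrakk>q \<in> Q; nz B b\<rbrakk> \<Longrightarrow> expansion b (\<tau> b q) (\<lambda>d. sM (\<phi> b d) q + \<gamma> q d) (C q)"
begin

lemma nz_B_ex: "\<exists>b. nz B b"
  using gen_ex[OF ev_nz[OF small_B]] .

lemma jet_Q [simp]: "q \<in> Q \<Longrightarrow> C q \<in> Q" "q \<in> Q \<Longrightarrow> \<gamma> q d \<in> Q"
proof -
  assume q: "q \<in> Q"
  obtain b where "nz B b" using nz_B_ex by blast
  from expansion_Q[OF jet[OF q this]] have "C q \<in> Q" "sM (\<phi> b d) q + \<gamma> q d - sM (\<phi> b d) q \<in> Q"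
    using q by (blast intro: Q_closed)+
  then show "C q \<in> Q" "\<gamma> q d \<in> Q" by simp_all
qed

text \<open>Linearity of \<gamma> and C is inherited from \<tau> through
  \<open>expansion_unique\<close>.\<close>

lemma jet_add [simp]:
  assumes "x \<in> Q" "y \<in> Q"
  shows "C (x + y) = C x + C y" "\<gamma> (x + y) d = \<gamma> x d + \<gamma> y d"
proof -
  obtain b where b: "nz B b" using nz_B_ex by blast
  have "expansion b (\<tau> b (x + y)) (\<lambda>d. (sM (\<phi> b d) x + \<gamma> x d) + (sM (\<phi> b d) y + \<gamma> y d)) (C x + C y)"
    unfolding tau_add by (rule expansion_add[OF jet[OF assms(1) b] jet[OF assms(2) b]])
  from expansion_unique[OF jet[OF Q_closed(1)[OF assms] b] this]
  show "C (x + y) = C x + C y" "\<gamma> (x + y) d = \<gamma> x d + \<gamma> y d"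
    by (auto simp: fun_eq_iff algebra_simps dest: spec[of _ d])
qed

lemma jet_scale [simp]:
  assumes "x \<in> Q"
  shows "C (sM c x) = sM c (C x)" "\<gamma> (sM c x) d = sM c (\<gamma> x d)"
proof -
  obtain b where b: "nz B b" using nz_B_ex by blast
  have "expansion b (\<tau> b (sM c x)) (\<lambda>d. sM c (sM (\<phi> b d) x + \<gamma> x d)) (sM c (C x))"
    unfolding tau_scale by (rule expansion_scale[OF jet[OF assms b]])
  from expansion_unique[OF jet[OF Q_closed(3)[OF assms] b] this]
  show "C (sM c x) = sM c (C x)" "\<gamma> (sM c x) d = sM c (\<gamma> x d)"
    by (auto simp: fun_eq_iff algebra_simps dest: spec[of _ d])
qed

lemma jet_add_d:
  assumes "q \<in> Q"
  shows "\<gamma> q (x + y) = \<gamma> q x + \<gamma> q y"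
proof -
  obtain b where b: "nz B b" using nz_B_ex by blast
  from jet[OF assms b] show ?thesis by (auto simp: expansion_def algebra_simps)
qed

text \<open>With \<open>\<phi> b d = 1\<close>, \<open>\<phi> a d = 0\<close> and q = s0 d,
  \<open>expansion_step\<close> yields a second expansion of \<open>\<tau> (a + b) q\<close>.
  Comparing it with the jet shows that m and \<open>\<tau> b q\<close> have the same expansion, so
  they are equal.\<close>

lemma wt_eq_tau:
  assumes "nz B b" "m \<in> wt (\<lambda>x. \<Lambda> x + \<phi> b x)"
  shows "\<exists>q\<in>Q. m = \<tau> b q"
proof -
  from expansion_ex[OF assms] obtain s0 s1 where m: "expansion b m s0 s1" by blast
  from eventually_conj[OF expansion_step[OF m] ev_ind2[OF small_B assms(1)]] gen_ex
  obtain a where a: "ind2 B b a" "\<And>d. van B d \<Longrightarrow> \<phi> a d = 0 \<Longrightarrow>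
    expansion (a + b) (\<tau> (a + b) (s0 d)) (\<lambda>d'. sM (\<phi> b d) (s0 d') + sM (\<phi> a d') (s0 d)) (sM (\<phi> b d) s1)"
    by blast
  from ind2_val[OF a(1), of 1 0] obtain d where d: "van B d" "\<phi> b d = 1" "\<phi> a d = 0" by blast
  have nz: "nz B (a + b)" using d by (auto intro!: nzI)
  define q where "q = s0 d"
  have q: "q \<in> Q" using expansion_Q[OF m] by (simp add: q_def)
  note u = expansion_unique[OF a(2)[OF d(1,3), folded q_def] jet[OF q nz]]
  have "s0 d' = sM (\<phi> b d') q + \<gamma> q d'" for d'
    using fun_cong[OF u(1), of d'] d by (simp add: algebra_simps)
  then have "s0 = (\<lambda>d. sM (\<phi> b d) q + \<gamma> q d)" "s1 = C q"
    using u(2) d by auto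
  with m have "m = \<tau> b q" using expansion_eqI[OF _ jet[OF q assms(1)]] by blast
  with q show ?thesis by blast
qed

text \<open>The jet covers only generic a. For a merely independent of b, take a generic c and e
  with values 0, 1, 0 on b, a, c: \<open>t c e\<close> kills \<open>\<tau> b q\<close>, so commuting
  it past \<open>t a d\<close> leads to the generic degrees c + a and c, while on degree a + b it is
  an injective shift.\<close>

lemma t_tau_full:
  assumes ind: "ind2 B b a" and q: "q \<in> Q"
  shows "t a d (\<tau> b q) = \<tau> (a + b) (sM (\<phi> b d) q + \<gamma> q d + sM (\<phi> a d) (C q))"
proof -
  from ind2_val[OF ind, of 1 0] have nz: "nz B b" "nz B (a + b)" by (auto intro!: nzI)
  have "t a d (\<tau> b q) \<in> wt (\<lambda>x. \<Lambda> x + \<phi> (a + b) x)"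
    using t_wt[OF tau_wt[OF q, of b], of a d] by (simp add: algebra_simps)
  from wt_eq_tau[OF nz(2) this] obtain y where y: "y \<in> Q" "t a d (\<tau> b q) = \<tau> (a + b) y" by blast
  note ev = expansion_ev[OF jet[OF q nz(1)]]
  from eventually_conj[OF ev_ind3[OF small_B ind] eventually_conj[OF ev ev_shift[OF ev, of a]]] gen_ex
  obtain c where c: "ind3 B b a c"
    "\<And>d. t c d (\<tau> b q) = \<tau> (c + b) (sM (\<phi> b d) q + \<gamma> q d + sM (\<phi> c d) (C q))"
    "\<And>d. t (c + a) d (\<tau> b q) = \<tau> (c + a + b) (sM (\<phi> b d) q + \<gamma> q d + sM (\<phi> (c + a) d) (C q))"
    by blast
  have indc: "ind2 B b c" using c(1) unfolding ind2_def ind3_def by meson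
  have indc': "ind2 B (a + b) c"
    unfolding ind2_def
  proof (intro allI)
    fix x y
    from ind3_val[OF c(1), of x 0 y] show "\<exists>d. van B d \<and> \<phi> (a + b) d = x \<and> \<phi> c d = y" by auto
  qed
  from ind3_val[OF c(1), of 0 1 0] obtain e where e: "van B e" "\<phi> b e = 0" "\<phi> a e = 1" "\<phi> c e = 0" by blast
  from ind2_val[OF indc, of 1 0] have nzc: "nz B (c + b)" by (auto intro!: nzI)
  from ind2_val[OF indc', of 1 0] have nzc': "nz B (c + (a + b))" by (auto intro!: nzI)
  have z: "t c e (\<tau> b q) = 0" using t_tau[OF indc e(1,4) q] e by simp
  then have g: "\<gamma> q e = 0" using c(2)[of e] e q tau_eq_0[OF nzc, of "\<gamma> q e"] by simp
  have "\<tau> (c + (a + b)) y = t c e (t a d (\<tau> b q))"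
    unfolding y(2) using t_tau[OF indc' e(1,4) y(1)] e by simp
  also have "\<dots> = t (c + a) d (\<tau> b q) - sM (\<phi> c d) (t (c + a) e (\<tau> b q))"
    using e z by (subst t_comm') simp
  also have "\<dots> = \<tau> (c + (a + b)) (sM (\<phi> b d) q + \<gamma> q d + sM (\<phi> a d) (C q))"
    unfolding c(3) using e by (simp add: g algebra_simps)
  finally have "y = sM (\<phi> b d) q + \<gamma> q d + sM (\<phi> a d) (C q)"
    using y(1) q by - (rule tau_inj[OF nzc'], auto)
  with y show ?thesis by simp
qed

text \<open>Evaluating [t^a d, t^c d] = (c(d) - a(d)) t^(a+c) d on \<open>\<tau> b q\<close> leaves
  c(d) - a(d) times the commutator of \<gamma> and C.\<close>

lemma jet_commute:
  assumes ind: "ind3 B b a c" and q: "q \<in> Q" and ne: "\<phi> c d \<noteq> \<phi> a d"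
  shows "\<gamma> (C q) d = C (\<gamma> q d)"
proof -
  have i: "ind2 B b a" "ind2 B b c" using ind unfolding ind2_def ind3_def by meson+
  have i1: "ind2 B (c + b) a" unfolding ind2_def
  proof (intro allI)
    fix x y
    from ind3_val[OF ind, of x y 0] show "\<exists>d. van B d \<and> \<phi> (c + b) d = x \<and> \<phi> a d = y" by auto
  qed
  have i2: "ind2 B (a + b) c" unfolding ind2_def
  proof (intro allI)
    fix x y
    from ind3_val[OF ind, of x 0 y] show "\<exists>d. van B d \<and> \<phi> (a + b) d = x \<and> \<phi> c d = y" by auto
  qed
  have i3: "ind2 B b (a + c)" unfolding ind2_def
  proof (intro allI)
    fix x y
    from ind3_val[OF ind, of x y 0] show "\<exists>d. van B d \<and> \<phi> b d = x \<and> \<phi> (a + c) d = y" by auto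
  qed
  from ind3_val[OF ind, of 1 0 0] have nz: "nz B (a + c + b)" by (auto intro!: nzI)
  define \<alpha> \<beta> \<zeta> where "\<alpha> = \<phi> a d" "\<beta> = \<phi> b d" "\<zeta> = \<phi> c d"
  define g where "g x = \<gamma> x d" for x
  have g: "x \<in> Q \<Longrightarrow> g x \<in> Q" "x \<in> Q \<Longrightarrow> y \<in> Q \<Longrightarrow> g (x + y) = g x + g y" "x \<in> Q \<Longrightarrow> g (sM k x) = sM k (g x)"
    for x y k by (simp_all add: g_def)
  define X where "X = sM \<beta> q + g q + sM \<zeta> (C q)"
  define Y where "Y = sM \<beta> q + g q + sM \<alpha> (C q)"
  have XY: "X \<in> Q" "Y \<in> Q" using q by (simp_all add: X_def Y_def g)
  have "t a d (t c d (\<tau> b q)) = \<tau> (a + c + b) (sM (\<zeta> + \<beta>) X + g X + sM \<alpha> (C X))"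
    using t_tau_full[OF i(2) q, of d] t_tau_full[OF i1 XY(1), of d]
    by (simp add: X_def g_def \<alpha>_\<beta>_\<zeta>_def add.assoc del: jet_add jet_scale tau_add tau_scale)
  moreover have "t c d (t a d (\<tau> b q)) = \<tau> (a + c + b) (sM (\<alpha> + \<beta>) Y + g Y + sM \<zeta> (C Y))"
    using t_tau_full[OF i(1) q, of d] t_tau_full[OF i2 XY(2), of d]
    by (simp add: Y_def g_def \<alpha>_\<beta>_\<zeta>_def add_ac del: jet_add jet_scale tau_add tau_scale)
  moreover have "t a d (t c d (\<tau> b q)) = t c d (t a d (\<tau> b q)) + sM (\<zeta> - \<alpha>) (t (a + c) d (\<tau> b q))"
    by (subst t_comm') (simp add: \<alpha>_\<beta>_\<zeta>_def algebra_simps)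
  moreover have "t (a + c) d (\<tau> b q) = \<tau> (a + c + b) (sM \<beta> q + g q + sM (\<alpha> + \<zeta>) (C q))"
    using t_tau_full[OF i3 q, of d] by (simp add: g_def \<alpha>_\<beta>_\<zeta>_def)
  ultimately have "\<tau> (a + c + b) (sM (\<zeta> + \<beta>) X + g X + sM \<alpha> (C X)) =
    \<tau> (a + c + b) (sM (\<alpha> + \<beta>) Y + g Y + sM \<zeta> (C Y) + sM (\<zeta> - \<alpha>) (sM \<beta> q + g q + sM (\<alpha> + \<zeta>) (C q)))"
    by simp
  then have "sM (\<zeta> + \<beta>) X + g X + sM \<alpha> (C X) =
    sM (\<alpha> + \<beta>) Y + g Y + sM \<zeta> (C Y) + sM (\<zeta> - \<alpha>) (sM \<beta> q + g q + sM (\<alpha> + \<zeta>) (C q))"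
    using q XY by - (rule tau_inj[OF nz], auto simp: g)
  then have "sM (\<zeta> - \<alpha>) (g (C q) - C (g q)) = 0"
    unfolding X_def Y_def using q by (simp add: g algebra_simps)
  with ne show ?thesis by (simp add: \<alpha>_\<beta>_\<zeta>_def g_def)
qed

text \<open>The bracket [t^a d, t^(-a) d] = -2 a(d) d ends in degree 0, where d acts by the known
  weight. As \<gamma> and C commute, the terms with C cancel and \<gamma> can be read off.\<close>

lemma jet_weight_aux:
  assumes ind: "ind2 B b a" and q: "q \<in> Q" and ne: "\<phi> a d \<noteq> 0"
  shows "\<gamma> q d = sM (\<Lambda> d) q"
proof -
  obtain c where c: "ind3 B b a c" using gen_ex[OF ev_ind3[OF small_B ind]] by blast
  \<comment> \<open>If c and a agree on d, then c + c and a do not, since \<open>\<phi> a d\<close>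
    is nonzero; so c or c + c is admissible in \<open>jet_commute\<close>.\<close>
  have c2: "ind3 B b a (c + c)" unfolding ind3_def
  proof (intro allI)
    fix x y z
    from ind3_val[OF c, of x y "z / 2"] show "\<exists>d. van B d \<and> \<phi> b d = x \<and> \<phi> a d = y \<and> \<phi> (c + c) d = z" by auto
  qed
  have comm: "\<gamma> (C q) d = C (\<gamma> q d)"
  proof (cases "\<phi> c d = \<phi> a d")
    case True
    then show ?thesis using jet_commute[OF c2 q, of d] ne by simp
  qed (use jet_commute[OF c q] in blast)
  have i: "ind2 B b (- a)" "ind2 B (- a + b) a" "ind2 B (a + b) (- a)"
    unfolding ind2_def
  proof safe
    fix x y
    from ind2_val[OF ind, of x "- y"] show "\<exists>d. van B d \<and> \<phi> b d = x \<and> \<phi> (- a) d = y" by auto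
    from ind2_val[OF ind, of "x + y" y] show "\<exists>d. van B d \<and> \<phi> (- a + b) d = x \<and> \<phi> a d = y" by auto
    from ind2_val[OF ind, of "x + y" "- y"] show "\<exists>d. van B d \<and> \<phi> (a + b) d = x \<and> \<phi> (- a) d = y" by auto
  qed
  from ind2_val[OF ind, of 1 0] have nz: "nz B b" by (auto intro!: nzI)
  define \<alpha> \<beta> where "\<alpha> = \<phi> a d" "\<beta> = \<phi> b d"
  define g where "g x = \<gamma> x d" for x
  have g: "x \<in> Q \<Longrightarrow> g x \<in> Q" "x \<in> Q \<Longrightarrow> y \<in> Q \<Longrightarrow> g (x + y) = g x + g y" "x \<in> Q \<Longrightarrow> g (sM k x) = sM k (g x)"
    "x \<in> Q \<Longrightarrow> y \<in> Q \<Longrightarrow> g (x - y) = g x - g y" for x y k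
    using jet_add(2)[of "x - y" y d] by (simp_all add: g_def)
  define X where "X = sM \<beta> q + g q - sM \<alpha> (C q)"
  define Y where "Y = sM \<beta> q + g q + sM \<alpha> (C q)"
  have XY: "X \<in> Q" "Y \<in> Q" using q by (simp_all add: X_def Y_def g)
  have C_diff: "C (x - y) = C x - C y" if "x \<in> Q" "y \<in> Q" for x y
    using jet_add(1)[of "x - y" y] that by simp
  have "t (- a) d (\<tau> b q) = \<tau> (- a + b) X"
    using t_tau_full[OF i(1) q, of d] by (simp add: X_def g_def \<alpha>_\<beta>_def)
  then have "t a d (t (- a) d (\<tau> b q)) = \<tau> b (sM (\<beta> - \<alpha>) X + g X + sM \<alpha> (C X))"
    using t_tau_full[OF i(2) XY(1), of d] by (simp add: g_def \<alpha>_\<beta>_def)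
  moreover have "t a d (\<tau> b q) = \<tau> (a + b) Y"
    using t_tau_full[OF ind q, of d] by (simp add: Y_def g_def \<alpha>_\<beta>_def)
  then have "t (- a) d (t a d (\<tau> b q)) = \<tau> b (sM (\<alpha> + \<beta>) Y + g Y - sM \<alpha> (C Y))"
    using t_tau_full[OF i(3) XY(2), of d] by (simp add: g_def \<alpha>_\<beta>_def)
  moreover have "t a d (t (- a) d (\<tau> b q)) = t (- a) d (t a d (\<tau> b q)) - (sM \<alpha> (t 0 d (\<tau> b q)) + sM \<alpha> (t 0 d (\<tau> b q)))"
    by (subst t_comm') (simp add: \<alpha>_\<beta>_def algebra_simps)
  moreover have "t 0 d (\<tau> b q) = \<tau> b (sM (\<Lambda> d + \<beta>) q)"
    using tau_wt[OF q, of b] by (simp add: wt_def \<alpha>_\<beta>_def)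
  ultimately have "\<tau> b (sM (\<beta> - \<alpha>) X + g X + sM \<alpha> (C X)) =
    \<tau> b (sM (\<alpha> + \<beta>) Y + g Y - sM \<alpha> (C Y) - (sM \<alpha> (sM (\<Lambda> d + \<beta>) q) + sM \<alpha> (sM (\<Lambda> d + \<beta>) q)))"
    by simp
  then have "sM (\<beta> - \<alpha>) X + g X + sM \<alpha> (C X) =
    sM (\<alpha> + \<beta>) Y + g Y - sM \<alpha> (C Y) - (sM \<alpha> (sM (\<Lambda> d + \<beta>) q) + sM \<alpha> (sM (\<Lambda> d + \<beta>) q))"
    using q XY by - (rule tau_inj[OF nz], auto simp: g)
  then have "sM \<alpha> (g q - sM (\<Lambda> d) q) + sM \<alpha> (g q - sM (\<Lambda> d) q) = 0"
    unfolding X_def Y_def using q comm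
    by (simp add: g C_diff g_def[of "C q", symmetric] g_def[of q, symmetric] algebra_simps)
  then have "sM (2 * \<alpha>) (g q - sM (\<Lambda> d) q) = 0"
    by (simp only: mult_2 M.scale_left_distrib)
  with ne show ?thesis by (simp add: \<alpha>_\<beta>_def g_def)
qed

lemma jet_weight: "q \<in> Q \<Longrightarrow> \<gamma> q d = sM (\<Lambda> d) q"
proof -
  assume q: "q \<in> Q"
  obtain b where "nz B b" using nz_B_ex by blast
  then obtain a where ind: "ind2 B b a" using gen_ex[OF ev_ind2[OF small_B]] by blast
  from ind2_val[OF this, of 0 1] obtain e where e: "\<phi> a e = 1" by blast
  show ?thesis
  proof (cases "\<phi> a d = 0")
    case True
    then have "\<gamma> q (d + e) = sM (\<Lambda> (d + e)) q" "\<gamma> q e = sM (\<Lambda> e) q"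
      using e by (auto intro!: jet_weight_aux[OF ind q])
    then show ?thesis
      by (simp add: jet_add_d[OF q] dual_add[OF weight_dual] M.scale_left_distrib)
  qed (rule jet_weight_aux[OF ind q])
qed

lemma jet_eigenvector:
  "\<exists>q\<in>Q. q \<noteq> 0 \<and> (\<exists>\<kappa>. \<forall>a b d. ind2 B b a \<longrightarrow>
    t a d (\<tau> b q) = sM (\<phi> b d + \<Lambda> d + \<kappa> * \<phi> a d) (\<tau> (a + b) q))"
proof -
  obtain S where S: "finite S" "Q \<subseteq> M.span S" using finite_Q by blast
  obtain w0 where w0: "w0 \<in> Q" "w0 \<noteq> 0" using nonzero_Q by blast
  have "\<exists>w\<in>Q. w \<noteq> 0 \<and> (\<exists>\<kappa>. C w = sM \<kappa> w)"
    by (rule eigenvector_exists[OF M.vector_space_axioms subspace_Q S w0]) auto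
  then obtain q \<kappa> where q: "q \<in> Q" "q \<noteq> 0" "C q = sM \<kappa> q" by blast
  have "t a d (\<tau> b q) = sM (\<phi> b d + \<Lambda> d + \<kappa> * \<phi> a d) (\<tau> (a + b) q)" if "ind2 B b a" for a b d
    using t_tau_full[OF that q(1), of d] q jet_weight[OF q(1)]
    by (simp add: M.scale_left_distrib mult.commute)
  with q show ?thesis by blast
qed

end

end

context nontrivial_witt_rep
begin

lemma generic_line:
  obtains \<Lambda> B \<kappa> and u :: "'g \<Rightarrow> 'm"
  where "\<Lambda> \<in> lin_dual sD" "small B" "\<And>b. nz B b \<Longrightarrow> u b \<noteq> 0"
    "\<And>a b d. ind2 B b a \<Longrightarrow> t a d (u b) = sM (\<phi> b d + \<Lambda> d + \<kappa> * \<phi> a d) (u (a + b))"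
proof (rule generic_sections, goal_cases)
  case (1 \<Lambda> B Q \<tau>)
  interpret witt_sections sD \<phi> sM t N \<Lambda> B Q \<tau>
    by unfold_locales (fact 1)+
  obtain \<gamma> C where jet: "\<And>q b. \<lbrakk>q \<in> Q; nz B b\<rbrakk> \<Longrightarrow> expansion b (\<tau> b q) (\<lambda>d. sM (\<phi> b d) q + \<gamma> q d) (C q)"
    by (rule expansion_tau) blast
  obtain q \<kappa> where "q \<in> Q" "q \<noteq> 0" "\<And>a b d. ind2 B b a \<Longrightarrow>
    t a d (\<tau> b q) = sM (\<phi> b d + \<Lambda> d + \<kappa> * \<phi> a d) (\<tau> (a + b) q)"
    using jet_eigenvector[OF jet] by blast
  then show ?thesis using that[of \<Lambda> B "\<lambda>b. \<tau> b q" \<kappa>] weight_dual small_B tau_eq_0 by blast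
qed

end

subsection \<open>Extension to all weights\<close>

locale witt_line = nontrivial_witt_rep sD \<phi> sM t N
  for sD :: "complex \<Rightarrow> 'd \<Rightarrow> 'd::ab_group_add"
    and \<phi> :: "'g::ab_group_add \<Rightarrow> 'd \<Rightarrow> complex"
    and sM :: "complex \<Rightarrow> 'm \<Rightarrow> 'm::ab_group_add"
    and t :: "'g \<Rightarrow> 'd \<Rightarrow> 'm \<Rightarrow> 'm"
    and N :: nat +
  fixes \<Lambda> :: "'d \<Rightarrow> complex" and B :: "('d \<Rightarrow> complex) set" and \<kappa> :: complex and u :: "'g \<Rightarrow> 'm"
  assumes weight_dual: "\<Lambda> \<in> lin_dual sD" and small_B: "small B"
    and u_nonzero: "nz B b \<Longrightarrow> u b \<noteq> 0"
    and t_u: "ind2 B b a \<Longrightarrow> t a d (u b) = sM (\<phi> b d + \<Lambda> d + \<kappa> * \<phi> a d) (u (a + b))"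
begin

definition P :: "'g \<Rightarrow> 'd \<Rightarrow> 'g \<Rightarrow> complex" where
  "P a d b = \<phi> b d + \<Lambda> d + \<kappa> * \<phi> a d"

lemma Lambda_simps [simp]:
  "\<Lambda> (x + y) = \<Lambda> x + \<Lambda> y" "\<Lambda> (x - y) = \<Lambda> x - \<Lambda> y" "\<Lambda> (sD c x) = c * \<Lambda> x"
  using weight_dual by (simp_all add: dual_add dual_diff dual_scale)

text \<open>\<open>t_u\<close> is silent when a depends on b, for instance for a = 0. Splitting a =
  (a - c) + c with c generic, \<open>t_bracket\<close> reduces to degrees where it applies.\<close>

lemma t_u_generic: "\<forall>\<^sub>F b in gen. \<forall>d. t a d (u b) = sM (P a d b) (u (a + b))"
proof -
  let ?B = "insert (\<phi> a) B"
  have sB: "small ?B" using small_B by simp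
  show ?thesis using ev_nz[OF sB]
  proof eventually_elim
    case (elim b)
    obtain c where c: "ind2 ?B b c" using gen_ex[OF ev_ind2[OF sB elim]] by blast
    have val: "\<exists>d. van B d \<and> \<phi> a d = 0 \<and> \<phi> b d = x \<and> \<phi> c d = y" for x y
      using ind2_val[OF c, of x y] by auto
    have i: "ind2 B b c" "ind2 B (c + b) (a - c)" "ind2 B b (a - c)" "ind2 B (a - c + b) c"
      unfolding ind2_def
    proof safe
      fix x y
      from val[of x y] show "\<exists>d. van B d \<and> \<phi> b d = x \<and> \<phi> c d = y" by auto
      from val[of "x + y" "- y"] show "\<exists>d. van B d \<and> \<phi> (c + b) d = x \<and> \<phi> (a - c) d = y" by auto
      from val[of x "- y"] show "\<exists>d. van B d \<and> \<phi> b d = x \<and> \<phi> (a - c) d = y" by auto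
      from val[of "x + y" y] show "\<exists>d. van B d \<and> \<phi> (a - c + b) d = x \<and> \<phi> c d = y" by auto
    qed
    from val[of 0 1] obtain e where e: "\<phi> a e = 0" "\<phi> b e = 0" "\<phi> c e = 1" by blast
    show ?case
    proof
      fix d
      define k where "k = \<phi> (a - c) d / 2"
      have k: "\<phi> a d = 2 * k + \<phi> c d" by (simp add: k_def diff_divide_distrib)
      have ab: "a - c + (c + b) = a + b" "c + (a - c + b) = a + b" by simp_all
      have "t a d (u b) = t (a - c) e (t c (d + sD k e) (u b)) - t c (d + sD k e) (t (a - c) e (u b))"
        unfolding k_def by (rule t_bracket[OF e(1,3)])
      also have "\<dots> = sM ((\<phi> b (d + sD k e) + \<Lambda> (d + sD k e) + \<kappa> * \<phi> c (d + sD k e)) *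
          (\<phi> (c + b) e + \<Lambda> e + \<kappa> * \<phi> (a - c) e) -
        (\<phi> b e + \<Lambda> e + \<kappa> * \<phi> (a - c) e) *
          (\<phi> (a - c + b) (d + sD k e) + \<Lambda> (d + sD k e) + \<kappa> * \<phi> c (d + sD k e))) (u (a + b))"
        by (simp only: t_u[OF i(1)] t_u[OF i(2)] t_u[OF i(3)] t_u[OF i(4)] t_scale M.scale_scale ab
            M.scale_left_diff_distrib)
      also have "(\<phi> b (d + sD k e) + \<Lambda> (d + sD k e) + \<kappa> * \<phi> c (d + sD k e)) *
          (\<phi> (c + b) e + \<Lambda> e + \<kappa> * \<phi> (a - c) e) -
        (\<phi> b e + \<Lambda> e + \<kappa> * \<phi> (a - c) e) *
          (\<phi> (a - c + b) (d + sD k e) + \<Lambda> (d + sD k e) + \<kappa> * \<phi> c (d + sD k e)) = P a d b"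
        using e by (simp add: P_def k algebra_simps)
      finally show "t a d (u b) = sM (P a d b) (u (a + b))" .
    qed
  qed
qed

lemma generic_affine_zero:
  assumes "\<forall>\<^sub>F a in gen. \<forall>d. x d + k * \<phi> a d = 0"
  shows "k = 0" "x d = 0"
proof -
  obtain a where a: "\<And>d. x d + k * \<phi> a d = 0" using assms gen_ex by blast
  have "\<forall>\<^sub>F c in gen. nz {\<phi> a} c" by (intro ev_nz) simp
  with assms have "\<forall>\<^sub>F c in gen. nz {\<phi> a} c \<and> (\<forall>d. x d + k * \<phi> c d = 0)"
    by eventually_elim simp
  then obtain c where c: "nz {\<phi> a} c" "\<And>d. x d + k * \<phi> c d = 0" using gen_ex by blast
  obtain e where "\<phi> a e = 0" "\<phi> c e = 1" using nz_val[OF c(1), of 1] by auto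
  with a[of e] c(2)[of e] show k: "k = 0" by simp
  show "x d = 0" using a[of d] k by simp
qed

text \<open>Generic elements act on m as they would on the basis vector t^b of Gamma(V^c, \<Lambda>)
  with c = \<kappa>.\<close>

definition extends :: "'g \<Rightarrow> 'm \<Rightarrow> bool" where
  "extends b m \<longleftrightarrow> (\<forall>\<^sub>F c in gen. \<forall>d. t c d m = sM (P c d b) (u (c + b)))"

definition S :: "'g set" where
  "S = {b. \<exists>m. extends b m}"

text \<open>The default 0 keeps \<open>U_wt\<close> true for every b; in \<open>t_U\<close> it is
  harmless, because the coefficient vanishes whenever a + b leaves \<open>S\<close>.\<close>

definition U :: "'g \<Rightarrow> 'm" where
  "U b = (if b \<in> S then SOME m. extends b m else 0)"

lemma extends_unique: "extends b m \<Longrightarrow> extends b m' \<Longrightarrow> m = m'"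
proof -
  assume "extends b m" "extends b m'"
  then have "\<forall>\<^sub>F c in gen. \<forall>d. t c d (m - m') = 0"
    unfolding extends_def by eventually_elim simp
  from generic_killed[OF this] show ?thesis by simp
qed

lemma extends_u: "nz B b \<Longrightarrow> extends b (u b)"
  unfolding extends_def P_def by (rule eventually_mono[OF ev_ind2[OF small_B]]) (auto intro: t_u)

lemma extends_U: "b \<in> S \<Longrightarrow> extends b (U b)"
  using someI_ex[of "extends b"] by (auto simp: U_def S_def)

lemma U_eqI: "extends b m \<Longrightarrow> U b = m"
  by (rule extends_unique[OF extends_U]) (auto simp: S_def)

text \<open>Commuting with \<open>t c d'\<close> reduces everything to degrees where P is known to
  give the action; the scalars match because P consists of the structure constants of a
  module.\<close>

lemma extends_t:
  assumes "extends b m"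
  shows "\<forall>\<^sub>F c in gen. \<forall>d'. t c d' (t a d m) = sM (P a d b * P c d' (a + b)) (u (c + (a + b)))"
proof -
  note ev = assms[unfolded extends_def]
  show ?thesis
    using ev ev_shift[OF ev, of a] ev_shift[OF t_u_generic[of a], of b]
  proof eventually_elim
    case (elim c)
    have eqs: "t c d' m = sM (P c d' b) (u (c + b))" "t (c + a) d' m = sM (P (c + a) d' b) (u (c + a + b))"
      "t a d' (u (c + b)) = sM (P a d' (c + b)) (u (a + (c + b)))" for d'
      using elim by blast+
    show ?case
    proof
      fix d'
      have e: "a + (c + b) = c + (a + b)" "c + a + b = c + (a + b)" by (simp_all add: algebra_simps)
      have "t c d' (t a d m) = sM (P c d' b * P a d (c + b) + \<phi> a d' * P (c + a) d b - \<phi> c d * P (c + a) d' b) (u (c + (a + b)))"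
        unfolding t_comm'[of c d' a d m] eqs(2) eqs(1) t_scale eqs(3) e
        by (simp add: M.scale_left_distrib M.scale_left_diff_distrib)
      also have "P c d' b * P a d (c + b) + \<phi> a d' * P (c + a) d b - \<phi> c d * P (c + a) d' b = P a d b * P c d' (a + b)"
        by (simp add: P_def algebra_simps)
      finally show "t c d' (t a d m) = sM (P a d b * P c d' (a + b)) (u (c + (a + b)))" .
    qed
  qed
qed

lemma S_step: "b \<in> S \<Longrightarrow> P a d b \<noteq> 0 \<Longrightarrow> a + b \<in> S"
  and t_U: "b \<in> S \<Longrightarrow> t a d (U b) = sM (P a d b) (U (a + b))"
proof -
  assume b: "b \<in> S"
  note ev = extends_t[OF extends_U[OF b], of a d]
  have ext: "extends (a + b) (sM (1 / P a d b) (t a d (U b)))" if "P a d b \<noteq> 0"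
    unfolding extends_def using ev by eventually_elim (use that in simp)
  then show "a + b \<in> S" if "P a d b \<noteq> 0" using that by (auto simp: S_def)
  show "t a d (U b) = sM (P a d b) (U (a + b))"
  proof (cases "P a d b = 0")
    case True
    have "\<forall>\<^sub>F c in gen. \<forall>d'. t c d' (t a d (U b)) = 0" using ev by eventually_elim (simp add: True)
    from generic_killed[OF this] True show ?thesis by simp
  next
    case False
    with U_eqI[OF ext[OF False]] show ?thesis by simp
  qed
qed

lemma U_generic: "nz B b \<Longrightarrow> b \<in> S \<and> U b = u b"
  using extends_u U_eqI by (auto simp: S_def)

text \<open>For generic a the degree b - a lies in \<open>S\<close>, so \<open>P a d (b - a)\<close>
  vanishes by \<open>S_step\<close>; it is affine in a with slope \<kappa> - 1. The possibly missing
  degree is the one removed in \<open>Gamma_inf\<close>.\<close>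

lemma not_S: "b \<notin> S \<Longrightarrow> \<kappa> = 1 \<and> (\<forall>d. \<phi> b d + \<Lambda> d = 0)"
proof -
  assume b: "b \<notin> S"
  have "\<forall>\<^sub>F a in gen. \<forall>d. (\<phi> b d + \<Lambda> d) + (\<kappa> - 1) * \<phi> a d = 0"
    using ev_reflect[OF ev_nz[OF small_B], of b]
  proof eventually_elim
    case (elim a)
    then have "P a d (b - a) = 0" for d using S_step[of "b - a" a d] U_generic b by auto
    then show ?case by (simp add: P_def algebra_simps)
  qed
  from generic_affine_zero[OF this] show ?thesis by simp
qed

text \<open>As \<open>u (c + b)\<close> is nonzero, \<open>P c d b\<close> vanishes for generic c;
  its slope in c is \<kappa>. This degree is the line divided out in
  \<open>Gamma_one\<close>.\<close>

lemma U_eq_0: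
  assumes "b \<in> S" "U b = 0"
  shows "\<kappa> = 0 \<and> (\<forall>d. \<phi> b d + \<Lambda> d = 0)"
proof -
  have "\<forall>\<^sub>F a in gen. \<forall>d. (\<phi> b d + \<Lambda> d) + \<kappa> * \<phi> a d = 0"
    using extends_U[OF assms(1), unfolded extends_def] ev_shift[OF ev_nz[OF small_B], of b]
    by eventually_elim (use u_nonzero assms in \<open>auto simp: P_def\<close>)
  from generic_affine_zero[OF this] show ?thesis by simp
qed

lemma U_zeroI: "\<kappa> = 0 \<Longrightarrow> (\<And>d. \<phi> b d + \<Lambda> d = 0) \<Longrightarrow> U b = 0"
proof (rule U_eqI)
  assume "\<kappa> = 0" "\<And>d. \<phi> b d + \<Lambda> d = 0"
  then have "P c d b = 0" for c d unfolding P_def by simp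
  then show "extends b 0" by (simp add: extends_def)
qed

lemma U_wt: "U b \<in> wt (\<lambda>x. \<Lambda> x + \<phi> b x)"
proof (cases "b \<in> S")
  case True
  then show ?thesis using t_U[OF True, of 0] by (simp add: wt_def P_def add.commute)
qed (simp add: U_def wt_def)

text \<open>Triviality of \<open>Ker1 \<phi>\<close> makes the weights distinct. Subtracting from
  \<open>t 0 d\<close> its scalar on \<open>x b0\<close> removes that term and leaves a shorter
  sum.\<close>

lemma wt_sum_zero:
  assumes "Ker1 \<phi> = {0}" "finite I" "\<And>b. b \<in> I \<Longrightarrow> x b \<in> wt (\<lambda>y. \<Lambda> y + \<phi> b y)" "sum x I = 0" "b \<in> I"
  shows "x b = 0"
  using assms(2-5)
proof (induction I arbitrary: x b rule: finite_induct)
  case (insert b0 I)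
  have x: "t 0 d (x b) = sM (\<Lambda> d + \<phi> b d) (x b)" if "b \<in> insert b0 I" for b d
    using insert.prems(1)[OF that] by (simp add: wt_def)
  have sum0: "x b0 = - sum x I" using insert by (simp add: eq_neg_iff_add_eq_0)
  have 0: "x b = 0" if b: "b \<in> I" for b
  proof -
    have "b - b0 \<notin> Ker1 \<phi>" using b insert assms(1) by auto
    then obtain d where d: "\<phi> b d \<noteq> \<phi> b0 d" by (auto simp: Ker1_def)
    define y where "y c = sM (\<phi> c d - \<phi> b0 d) (x c)" for c
    have "sum y I = (\<Sum>c\<in>I. t 0 d (x c) - sM (\<Lambda> d + \<phi> b0 d) (x c))"
      by (intro sum.cong) (auto simp: y_def x algebra_simps)
    also have "\<dots> = t 0 d (sum x I) - sM (\<Lambda> d + \<phi> b0 d) (sum x I)"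
    proof -
      have "t 0 d (sum x I) = (\<Sum>c\<in>I. t 0 d (x c))"
        by (induction I rule: infinite_finite_induct) auto
      then show ?thesis by (simp add: sum_subtractf M.scale_sum_right)
    qed
    also have "\<dots> = 0"
      using x[of b0 d] by (simp add: sum0)
    finally have "sum y I = 0" .
    moreover have "y c \<in> wt (\<lambda>y. \<Lambda> y + \<phi> c y)" if "c \<in> I" for c
      unfolding y_def using insert.prems(1) that by (intro M.subspace_scale[OF subspace_wt]) auto
    ultimately have "y b = 0" using insert.IH[where x = y] b by blast
    with d show ?thesis by (simp add: y_def)
  qed
  then have "sum x I = 0" by simp
  with 0 sum0 insert.prems(3) show ?case by auto
qed simp

text \<open>Closedness of T under steps with nonzero coefficient makes the span a submodule. A
  proper T is taken for \<kappa> = 1, where one degree is left out whether or not it lies in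
  \<open>S\<close>.\<close>

lemma span_U:
  assumes simple: "\<And>V. \<lbrakk>M.subspace V; \<And>a d v. v \<in> V \<Longrightarrow> t a d v \<in> V\<rbrakk> \<Longrightarrow> V = {0} \<or> V = UNIV"
    and T: "T \<subseteq> S" "\<And>a b d. \<lbrakk>b \<in> T; P a d b \<noteq> 0\<rbrakk> \<Longrightarrow> a + b \<in> T" "\<exists>b\<in>T. U b \<noteq> 0"
  shows "M.span (U ` T) = UNIV"
proof -
  have "t a d v \<in> M.span (U ` T)" if "v \<in> M.span (U ` T)" for a d v
    using that
  proof (induction rule: M.span_induct_alt)
    case (step c x y)
    then obtain b where b: "b \<in> T" "x = U b" by blast
    have "t a d x \<in> M.span (U ` T)"
    proof (cases "P a d b = 0")
      case False
      then have "U (a + b) \<in> M.span (U ` T)" using T(2) b by (intro M.span_base) blast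
      then show ?thesis using b T by (auto simp: t_U subset_eq intro: M.span_scale)
    qed (use b T in \<open>auto simp: t_U subset_eq M.span_zero\<close>)
    with step show ?case by (simp add: M.span_add M.span_scale)
  qed (simp add: M.span_zero)
  then have "M.span (U ` T) = {0} \<or> M.span (U ` T) = UNIV" by (intro simple) auto
  moreover obtain b where b: "b \<in> T" "U b \<noteq> 0" using T(3) by blast
  then have "U b \<in> M.span (U ` T)" by (intro M.span_base) blast
  ultimately show ?thesis using b by auto
qed

end

subsection \<open>Identification with the modules of tensor densities\<close>

text \<open>The natural map runs from the concrete model N to M, while \<open>module_iso\<close>
  asks for a map out of M; closure of \<open>carr N\<close> under the operations allows passing to
  the inverse.\<close>

lemma module_isoI:
  assumes bij: "bij_betw G (carr N) (carr M)"
    and add: "\<And>x y. \<lbrakk>x \<in> carr N; y \<in> carr N\<rbrakk> \<Longrightarrow> madd N x y \<in> carr N \<and> G (madd N x y) = madd M (G x) (G y)"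
    and smult: "\<And>z x. x \<in> carr N \<Longrightarrow> msmult N z x \<in> carr N \<and> G (msmult N z x) = msmult M z (G x)"
    and act: "\<And>w x. x \<in> carr N \<Longrightarrow> mact N w x \<in> carr N \<and> G (mact N w x) = mact M w (G x)"
  shows "M \<cong>\<^sub>W N"
proof -
  define F where "F = the_inv_into (carr N) G"
  have inj: "inj_on G (carr N)" using bij by (simp add: bij_betw_def)
  have bF: "bij_betw F (carr M) (carr N)" unfolding F_def by (rule bij_betw_the_inv_into[OF bij])
  have F: "F x \<in> carr N" "G (F x) = x" if "x \<in> carr M" for x
    using bij that bF by (auto simp: F_def f_the_inv_into_f_bij_betw bij_betw_apply)
  have FG: "F (G x) = x" if "x \<in> carr N" for x
    unfolding F_def by (rule the_inv_into_f_f[OF inj that])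
  have "F (madd M x y) = madd N (F x) (F y)" if "x \<in> carr M" "y \<in> carr M" for x y
    using add[OF F(1)[OF that(1)] F(1)[OF that(2)]] FG F(2) that by metis
  moreover have "F (msmult M z x) = msmult N z (F x)" if "x \<in> carr M" for x z
    using smult[OF F(1)[OF that]] FG F(2) that by metis
  moreover have "F (mact M w x) = mact N w (F x)" if "x \<in> carr M" for x w
    using act[OF F(1)[OF that]] FG F(2) that by metis
  ultimately show ?thesis unfolding module_iso_def using bF by blast
qed

lemma lookup_scaleA: "Poly_Mapping.lookup (scaleA z f) b = z * Poly_Mapping.lookup f b"
  by (simp add: scaleA_def Poly_Mapping.map.rep_eq when_def)

lemma poly_mapping_sum_singles: "(\<Sum>a\<in>Poly_Mapping.keys x. Poly_Mapping.single a (Poly_Mapping.lookup x a)) = x"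
  by (rule poly_mapping_eqI)
    (simp add: lookup_sum lookup_single when_def in_keys_iff sum.delta)

context witt_line
begin

definition Psi :: "('g \<Rightarrow>\<^sub>0 complex) \<Rightarrow> 'm" where
  "Psi f = (\<Sum>b\<in>Poly_Mapping.keys f. sM (Poly_Mapping.lookup f b) (U b))"

lemma Psi_superset:
  "finite A \<Longrightarrow> Poly_Mapping.keys f \<subseteq> A \<Longrightarrow> Psi f = (\<Sum>b\<in>A. sM (Poly_Mapping.lookup f b) (U b))"
  unfolding Psi_def by (intro sum.mono_neutral_left) (auto simp: in_keys_iff)

lemma Psi_add: "Psi (f + g) = Psi f + Psi g"
proof -
  let ?A = "Poly_Mapping.keys f \<union> Poly_Mapping.keys g"
  have "Psi (f + g) = (\<Sum>b\<in>?A. sM (Poly_Mapping.lookup (f + g) b) (U b))"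
    using keys_add[of f g] by (intro Psi_superset) auto
  also have "\<dots> = (\<Sum>b\<in>?A. sM (Poly_Mapping.lookup f b) (U b)) + (\<Sum>b\<in>?A. sM (Poly_Mapping.lookup g b) (U b))"
    by (simp add: lookup_add M.scale_left_distrib sum.distrib)
  also have "\<dots> = Psi f + Psi g" by (subst (1 2) Psi_superset[of ?A]) auto
  finally show ?thesis .
qed

lemma Psi_0 [simp]: "Psi 0 = 0"
  by (simp add: Psi_def)

lemma Psi_diff: "Psi (f - g) = Psi f - Psi g"
  using Psi_add[of "f - g" g] by simp

lemma Psi_sum: "Psi (sum h I) = (\<Sum>i\<in>I. Psi (h i))"
  by (induction I rule: infinite_finite_induct) (auto simp: Psi_add)

lemma Psi_single [simp]: "Psi (Poly_Mapping.single b z) = sM z (U b)"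
  by (cases "z = 0") (simp_all add: Psi_def)

lemma Psi_scale: "Psi (scaleA z f) = sM z (Psi f)"
proof -
  have "Poly_Mapping.keys (scaleA z f) \<subseteq> Poly_Mapping.keys f"
    by (auto simp: in_keys_iff lookup_scaleA)
  then have "Psi (scaleA z f) = (\<Sum>b\<in>Poly_Mapping.keys f. sM (Poly_Mapping.lookup (scaleA z f) b) (U b))"
    by (intro Psi_superset) auto
  then show ?thesis by (simp add: Psi_def lookup_scaleA M.scale_sum_right)
qed

lemma Psi_act:
  assumes "Poly_Mapping.keys f \<subseteq> S"
  shows "Psi (Gamma_act \<phi> \<kappa> \<Lambda> w f) = (\<Sum>a\<in>Poly_Mapping.keys w. t a (Poly_Mapping.lookup w a) (Psi f))"
proof -
  have t_sum: "t a d (sum h I) = (\<Sum>i\<in>I. t a d (h i))" for a d h and I :: "'g set"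
    by (induction I rule: infinite_finite_induct) auto
  have *: "t a d (U b) = sM (\<phi> b d + \<Lambda> d + \<kappa> * \<phi> a d) (U (a + b))"
    if "b \<in> Poly_Mapping.keys f" for a b d
    using t_U[of b a d] that assms by (auto simp: P_def)
  show ?thesis
    unfolding Gamma_act_def Let_def Psi_sum Psi_single
    by (intro sum.cong refl) (simp add: Psi_def t_sum * mult.commute)
qed

lemma Psi_span: "M.span (U ` T) \<subseteq> Psi ` {f. Poly_Mapping.keys f \<subseteq> T}"
proof
  fix v assume "v \<in> M.span (U ` T)"
  then show "v \<in> Psi ` {f. Poly_Mapping.keys f \<subseteq> T}"
  proof (induction rule: M.span_induct_alt)
    case base
    show ?case by (rule image_eqI[of _ _ 0]) auto
  next
    case (step c x y)
    then obtain b f where b: "b \<in> T" "x = U b" "y = Psi f" "Poly_Mapping.keys f \<subseteq> T" by blast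
    have "Poly_Mapping.keys (Poly_Mapping.single b c + f) \<subseteq> T"
      using b keys_add[of "Poly_Mapping.single b c" f] by (auto split: if_splits)
    with b show ?case by (intro image_eqI[of _ _ "Poly_Mapping.single b c + f"]) (auto simp: Psi_add)
  qed
qed

lemma Psi_eq_0:
  assumes "Ker1 \<phi> = {0}" "Psi f = 0" "U b \<noteq> 0"
  shows "Poly_Mapping.lookup f b = 0"
proof (cases "b \<in> Poly_Mapping.keys f")
  case True
  have "sM (Poly_Mapping.lookup f b) (U b) = 0"
    by (rule wt_sum_zero[OF assms(1) finite_keys _ _ True])
      (use assms(2) in \<open>auto simp: Psi_def U_wt intro: M.subspace_scale[OF subspace_wt]\<close>)
  with assms(3) show ?thesis by simp
qed (simp add: in_keys_iff)

lemma Psi_bij: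
  assumes "Ker1 \<phi> = {0}" and U: "\<And>b. b \<in> T \<Longrightarrow> U b \<noteq> 0" and span: "M.span (U ` T) = UNIV"
  shows "bij_betw Psi {f. Poly_Mapping.keys f \<subseteq> T} UNIV"
  unfolding bij_betw_def
proof
  show "Psi ` {f. Poly_Mapping.keys f \<subseteq> T} = UNIV" using Psi_span[of T] span by auto
  show "inj_on Psi {f. Poly_Mapping.keys f \<subseteq> T}"
  proof (rule inj_onI, rule poly_mapping_eqI)
    fix f g b assume fg: "f \<in> {f. Poly_Mapping.keys f \<subseteq> T}" "g \<in> {f. Poly_Mapping.keys f \<subseteq> T}" "Psi f = Psi g"
    show "Poly_Mapping.lookup f b = Poly_Mapping.lookup g b"
    proof (cases "b \<in> T")
      case True
      then show ?thesis
        using Psi_eq_0[OF assms(1), of "f - g" b] U fg by (simp add: Psi_diff lookup_minus)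
    next
      case False
      then have "b \<notin> Poly_Mapping.keys f" "b \<notin> Poly_Mapping.keys g" using fg by auto
      then show ?thesis by (simp add: in_keys_iff)
    qed
  qed
qed

theorem classification:
  assumes Ker1: "Ker1 \<phi> = {0}"
    and simple: "\<And>V. \<lbrakk>M.subspace V; \<And>a d v. v \<in> V \<Longrightarrow> t a d v \<in> V\<rbrakk> \<Longrightarrow> V = {0} \<or> V = UNIV"
    and act: "\<And>x v. act x v = (\<Sum>a\<in>Poly_Mapping.keys x. t a (Poly_Mapping.lookup x a) v)"
  shows "(\<exists>c. \<exists>\<sigma>\<in>lin_dual sD. (\<sigma> \<notin> range \<phi> \<or> c \<notin> {0, 1}) \<and> full_struct sM act \<cong>\<^sub>W Gamma \<phi> c \<sigma>)
    \<or> (\<exists>s. full_struct sM act \<cong>\<^sub>W Gamma_one \<phi> s \<or> full_struct sM act \<cong>\<^sub>W Gamma_inf \<phi> s)"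
proof -
  have act_Psi: "Psi (Gamma_act \<phi> \<kappa> \<Lambda> w f) = act w (Psi f)" if "Poly_Mapping.keys f \<subseteq> S" for w f
    using Psi_act[OF that] act by simp
  have gen_S: "\<exists>b. b \<in> S \<and> b \<noteq> c \<and> U b \<noteq> 0" for c
  proof -
    have "\<forall>\<^sub>F b in gen. nz B b \<and> nz {\<phi> c} b" using small_B by (intro eventually_conj ev_nz) auto
    then obtain b where b: "nz B b" "nz {\<phi> c} b" using gen_ex by blast
    then have "b \<noteq> c" by (auto simp: nz_def)
    with b show ?thesis using U_generic u_nonzero by metis
  qed
  show ?thesis
  proof (cases "\<Lambda> \<notin> range \<phi> \<or> \<kappa> \<notin> {0, 1}")
    case True
    \<comment> \<open>An exceptional degree b needs \<kappa> in {0, 1} and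
      \<open>\<Lambda> = \<phi> (- b)\<close>, which this case excludes; so every degree carries a
      nonzero \<open>U b\<close>.\<close>
    have no: "\<not> ((\<kappa> = 0 \<or> \<kappa> = 1) \<and> (\<forall>d. \<phi> b d + \<Lambda> d = 0))" for b
    proof
      assume *: "(\<kappa> = 0 \<or> \<kappa> = 1) \<and> (\<forall>d. \<phi> b d + \<Lambda> d = 0)"
      then have "\<Lambda> = \<phi> (- b)" by (simp add: fun_eq_iff eq_neg_iff_add_eq_0 add.commute)
      with True * show False by auto
    qed
    have S: "S = UNIV" using no not_S by blast
    have U: "U b \<noteq> 0" for b using no U_eq_0[of b] S by blast
    have "bij_betw Psi {f. Poly_Mapping.keys f \<subseteq> UNIV} UNIV"
      using span_U[OF simple, of UNIV] S U by (intro Psi_bij[OF Ker1]) auto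
    then have "full_struct sM act \<cong>\<^sub>W Gamma \<phi> \<kappa> \<Lambda>"
      by (intro module_isoI[of Psi])
        (auto simp: Gamma_def full_struct_def Psi_add Psi_scale act_Psi S)
    with True weight_dual show ?thesis by blast
  next
    case False
    then obtain s where s: "\<Lambda> = \<phi> s" and k: "\<kappa> = 0 \<or> \<kappa> = 1" by auto
    have zero: "b = - s" if "\<forall>d. \<phi> b d + \<Lambda> d = 0" for b
    proof -
      have "b + s \<in> Ker1 \<phi>" using that by (simp add: Ker1_def s)
      with Ker1 show ?thesis by (simp add: eq_neg_iff_add_eq_0)
    qed
    from k show ?thesis
    proof
      assume k0: "\<kappa> = 0"
      have S: "S = UNIV" using not_S k0 by force
      have Us: "U (- s) = 0" by (rule U_zeroI[OF k0]) (simp add: s)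
      have U: "U b \<noteq> 0" if "b \<noteq> - s" for b using U_eq_0[of b] zero that S by blast
      let ?K = "range (Poly_Mapping.single (- s)) :: ('g \<Rightarrow>\<^sub>0 complex) set"
      have ker: "f \<in> ?K \<longleftrightarrow> Psi f = 0" for f
      proof
        assume "Psi f = 0"
        then have "Poly_Mapping.lookup f b = 0" if "b \<noteq> - s" for b
          using Psi_eq_0[OF Ker1 _ U[OF that]] by blast
        then have "f = Poly_Mapping.single (- s) (Poly_Mapping.lookup f (- s))"
          by (intro poly_mapping_eqI) (auto simp: lookup_single when_def)
        then show "f \<in> ?K" by blast
      qed (auto simp: Us)
      define r where "r = {(x, y). x - y \<in> ?K}"
      have r: "r `` {x} = Psi -` {Psi x}" for x
        by (auto simp: r_def ker Psi_diff)
      have "M.span (range U) = UNIV"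
        by (rule span_U[OF simple]) (use S gen_S in auto)
      then have surj: "\<exists>f. Psi f = v" for v using Psi_span[of UNIV] by (metis UNIV_I imageE subsetD)
      \<comment> \<open>The classes of r are the fibres of the surjection \<open>Psi\<close>, so F
        inverts the map induced on the quotient.\<close>
      define F where "F v = Psi -` {v}" for v
      have inj: "inj F"
      proof
        fix v w assume "F v = F w"
        then show "v = w" using surj[of v] by (auto simp: F_def)
      qed
      have "F v \<in> UNIV // r" for v
        using surj[of v] by (auto simp: F_def quotient_def r)
      moreover have "X \<in> range F" if "X \<in> UNIV // r" for X
        using that by (auto simp: F_def quotient_def r)
      ultimately have "bij_betw F UNIV (UNIV // r)" using inj by (auto simp: bij_betw_def)
      moreover have "F (x + y) = (\<Union>f\<in>F x. \<Union>g\<in>F y. r `` {f + g})" for x y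
        using surj[of x] surj[of y] by (auto simp: F_def r Psi_add)
      moreover have "F (sM z x) = (\<Union>f\<in>F x. r `` {scaleA z f})" for x z
        using surj[of x] by (auto simp: F_def r Psi_scale)
      moreover have act0: "Psi (Gamma_act \<phi> 0 (\<phi> s) w f) = act w (Psi f)" for w f
        using act_Psi[of f w] S unfolding k0 s by simp
      then have "F (act w x) = (\<Union>f\<in>F x. r `` {Gamma_act \<phi> 0 (\<phi> s) w f})" for x w
        using surj[of x] by (auto simp: F_def r)
      ultimately have "full_struct sM act \<cong>\<^sub>W Gamma_one \<phi> s"
        unfolding module_iso_def Gamma_one_def quot_struct_def full_struct_def Let_def r_def[symmetric]
        by (intro exI[of _ F]) simp
      then show ?thesis by blast
    next
      assume k1: "\<kappa> = 1"
      \<comment> \<open>For \<kappa> = 1 no step leads from another degree into -s, so by simplicity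
        the remaining degrees already span M.\<close>
      let ?T = "{a. a \<noteq> - s}"
      have T: "?T \<subseteq> S" using not_S zero by blast
      have U: "U b \<noteq> 0" if "b \<in> ?T" for b using U_eq_0[of b] T that k1 by auto
      have "M.span (U ` ?T) = UNIV"
      proof (rule span_U[OF simple T])
        show "a + b \<in> ?T" if "b \<in> ?T" "P a d b \<noteq> 0" for a b d
        proof (rule CollectI, rule notI)
          assume "a + b = - s"
          then have "\<phi> (a + b + s) d = 0" by simp
          moreover have "P a d b = \<phi> b d + \<phi> s d + \<phi> a d" unfolding P_def by (simp add: k1 s)
          ultimately show False using that(2) by (simp add: add_ac)
        qed
        show "\<exists>b\<in>?T. U b \<noteq> 0" using gen_S[of "- s"] by blast
      qed auto
      then have bij: "bij_betw Psi {f. Poly_Mapping.keys f \<subseteq> ?T} UNIV" by (intro Psi_bij[OF Ker1] U)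
      have closed: "Poly_Mapping.keys (Gamma_act \<phi> 1 (\<phi> s) w f) \<subseteq> ?T" for w and f :: "'g \<Rightarrow>\<^sub>0 complex"
      proof -
        \<comment> \<open>The coefficient into degree -s is \<open>\<phi> (a + b + s) d\<close>,
          which is zero.\<close>
        have "(\<phi> b d + \<phi> s d + 1 * \<phi> a d) * x = 0" if "a + b = - s" for a b d x
        proof -
          have "\<phi> (a + b + s) d = 0" using that by simp
          then show ?thesis by (simp add: add_ac)
        qed
        then have "Poly_Mapping.lookup (Gamma_act \<phi> 1 (\<phi> s) w f) (- s) = 0"
          unfolding Gamma_act_def Let_def lookup_sum
          by (intro sum.neutral ballI) (auto simp: lookup_single when_def)
        then show ?thesis by (auto simp: in_keys_iff)
      qed
      have T_iff: "Poly_Mapping.keys f \<subseteq> ?T \<longleftrightarrow> Poly_Mapping.lookup f (- s) = 0" for f :: "'g \<Rightarrow>\<^sub>0 complex"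
        by (auto simp: in_keys_iff)
      have act1: "Psi (Gamma_act \<phi> 1 (\<phi> s) w f) = act w (Psi f)" if "Poly_Mapping.keys f \<subseteq> ?T" for w f
        using act_Psi[of f w] T that unfolding k1 s by blast
      have "full_struct sM act \<cong>\<^sub>W Gamma_inf \<phi> s"
      proof (rule module_isoI[of Psi])
        show "bij_betw Psi (carr (Gamma_inf \<phi> s)) (carr (full_struct sM act))"
          using bij by (simp add: Gamma_inf_def sub_struct_def full_struct_def)
      qed (use closed act1 in
          \<open>auto simp: Gamma_inf_def sub_struct_def full_struct_def Psi_add Psi_scale T_iff lookup_add lookup_scaleA\<close>)
      then show ?thesis by blast
    qed
  qed
qed

end

subsection \<open>Simple bounded modules\<close>

text \<open>In the induction S grows only if some x0 in V is killed by B but not by g; a multiple of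
  x0 then corrects the value of g without disturbing B.\<close>

lemma finite_codim:
  assumes "vector_space sD" "module.subspace sD V" "finite B" "B \<subseteq> lin_dual sD"
  shows "\<exists>S. finite S \<and> S \<subseteq> V \<and> (\<forall>x\<in>V. \<exists>y\<in>module.span sD S. \<forall>f\<in>B. f (x - y) = 0)"
  using assms(3,4)
proof (induction B rule: finite_induct)
  case empty
  interpret vector_space sD by fact
  show ?case by (intro exI[of _ "{}"]) auto
next
  case (insert g B)
  interpret vector_space sD by fact
  have lin: "f (x + y) = f x + f y" "f (sD c x) = c * f x" if "f \<in> insert g B" for f x y c
    using insert.prems that by (auto simp: lin_dual_iff[OF assms(1)])
  have diff: "f (x - y) = f x - f y" if "f \<in> insert g B" for f x y
    using lin(1)[OF that, of "x - y" y] by simp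
  obtain S where S: "finite S" "S \<subseteq> V" "\<And>x. x \<in> V \<Longrightarrow> \<exists>y\<in>span S. \<forall>f\<in>B. f (x - y) = 0"
    using insert by auto
  have SV: "span S \<subseteq> V" by (rule span_minimal[OF S(2) assms(2)])
  show ?case
  proof (cases "\<forall>x\<in>V. (\<forall>f\<in>B. f x = 0) \<longrightarrow> g x = 0")
    case True
    have "\<exists>y\<in>span S. \<forall>f\<in>insert g B. f (x - y) = 0" if x: "x \<in> V" for x
    proof -
      obtain y where y: "y \<in> span S" "\<forall>f\<in>B. f (x - y) = 0" using S(3)[OF x] by blast
      then have "x - y \<in> V" using x SV assms(2) by (auto intro: subspace_diff)
      with True y show ?thesis by blast
    qed
    then show ?thesis using S(1,2) by (intro exI[of _ S] conjI ballI)
  next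
    case False
    then obtain x0 where x0: "x0 \<in> V" "\<forall>f\<in>B. f x0 = 0" "g x0 \<noteq> 0" by blast
    have "\<exists>y\<in>span (insert x0 S). \<forall>f\<in>insert g B. f (x - y) = 0" if x: "x \<in> V" for x
    proof -
      obtain y where y: "y \<in> span S" "\<forall>f\<in>B. f (x - y) = 0" using S(3)[OF x] by blast
      define y' where "y' = y + sD (g (x - y) / g x0) x0"
      have "y' \<in> span (insert x0 S)"
        unfolding y'_def using y span_mono[of S "insert x0 S"]
        by (intro span_add[OF _ span_scale]) (auto intro: span_base)
      moreover have "f (x - y') = 0" if f: "f \<in> insert g B" for f
      proof -
        have "f (x - y') = f (x - y) - g (x - y) / g x0 * f x0"
          unfolding y'_def by (simp only: diff[OF f] lin[OF f]) simp
        then show ?thesis using f x0 y by auto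
      qed
      ultimately show ?thesis by blast
    qed
    then show ?thesis using S(1,2) x0(1) by (intro exI[of _ "insert x0 S"] conjI ballI) simp_all
  qed
qed

theorem theorem4p13:
  fixes sD :: "complex \<Rightarrow> 'd \<Rightarrow> 'd::ab_group_add"
    and \<phi> :: "'g::ab_group_add \<Rightarrow> 'd \<Rightarrow> complex"
    and Dbar :: "'d set"
    and sM :: "complex \<Rightarrow> 'm \<Rightarrow> 'm::ab_group_add"
    and act :: "('g \<Rightarrow>\<^sub>0 'd) \<Rightarrow> 'm \<Rightarrow> 'm"
  assumes "\<exists>a::'g. a \<noteq> 0"
    and "vector_space sD"
    and "\<And>a b d. \<phi> (a + b) d = \<phi> a d + \<phi> b d"
    and "\<And>a. Vector_Spaces.linear sD (*) (\<phi> a)"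
    and "module.subspace sD Dbar"
    and "Dbar \<inter> Ker2 \<phi> = {0}"
    and "{x + y | x y. x \<in> Dbar \<and> y \<in> Ker2 \<phi>} = UNIV"
    and "Ker1 \<phi> = {0}"
    and "\<not> fin_dim sD Dbar"
    and "W_module sD \<phi> sM act"
    and "simple_module sM act"
    and "bounded_module sD sM act"
  shows "(\<exists>c. \<exists>\<sigma>\<in>lin_dual sD. (\<sigma> \<notin> range \<phi> \<or> c \<notin> {0, 1}) \<and> full_struct sM act \<cong>\<^sub>W Gamma \<phi> c \<sigma>)
    \<or> (\<exists>s. full_struct sM act \<cong>\<^sub>W Gamma_one \<phi> s \<or> full_struct sM act \<cong>\<^sub>W Gamma_inf \<phi> s)
    \<or> (vector_space.dim sM (UNIV :: 'm set) = 1 \<and> (\<forall>x v. act x v = 0))"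
proof -
  have vsM: "vector_space sM"
    and act_v: "\<And>x v w. act x (v + w) = act x v + act x w" "\<And>x z v. act x (sM z v) = sM z (act x v)"
    and act_x: "\<And>x y v. act (x + y) v = act x v + act y v" "\<And>x z v. act (scaleW sD z x) v = sM z (act x v)"
    and act_bracket: "\<And>x y v. act (bracketW sD \<phi> x y) v = act x (act y v) - act y (act x v)"
    using assms(10) by (auto simp: W_module_def Vector_Spaces.linear_iff)
  interpret D: vector_space sD by fact
  interpret M: vector_space sM by fact
  define t where "t a d = act (Poly_Mapping.single a d)" for a d
  have act_0: "act 0 v = 0" for v using act_x(1)[of 0 0 v] by simp
  have act_sum: "act (sum h I) v = (\<Sum>i\<in>I. act (h i) v)" for h v and I :: "'g set"
    by (induction I rule: infinite_finite_induct) (auto simp: act_x act_0)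
  have act_t: "act x v = (\<Sum>a\<in>Poly_Mapping.keys x. t a (Poly_Mapping.lookup x a) v)" for x v
    by (subst poly_mapping_sum_singles[of x, symmetric], subst act_sum) (simp add: t_def)
  have single_scale: "Poly_Mapping.single a (sD z d) = scaleW sD z (Poly_Mapping.single a d)"
    for a :: 'g and z d
    by (rule poly_mapping_eqI) (simp add: lookup_scaleW[OF assms(2)] lookup_single when_def)
  interpret pairing sD \<phi>
  proof unfold_locales
    show "\<exists>a d. (\<forall>f\<in>B. f d = 0) \<and> \<phi> a d \<noteq> 0" if B: "finite B" "B \<subseteq> lin_dual sD" for B
    proof (rule ccontr)
      \<comment> \<open>If \<phi> vanished on the annihilator of B, elements of \<open>Dbar\<close>
        would agree with elements of \<open>D.span S\<close> up to
        \<open>Dbar \<inter> Ker2 \<phi>\<close>, so the finite S would span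
        \<open>Dbar\<close>.\<close>
      assume n: "\<not> ?thesis"
      from finite_codim[OF assms(2,5) B] obtain S where
        S: "finite S" "S \<subseteq> Dbar" "\<And>x. x \<in> Dbar \<Longrightarrow> \<exists>y\<in>D.span S. \<forall>f\<in>B. f (x - y) = 0" by blast
      have SV: "D.span S \<subseteq> Dbar" by (rule D.span_minimal[OF S(2) assms(5)])
      have "x \<in> D.span S" if x: "x \<in> Dbar" for x
      proof -
        obtain y where y: "y \<in> D.span S" "\<forall>f\<in>B. f (x - y) = 0" using S(3)[OF x] by blast
        then have "x - y \<in> Dbar" using x SV assms(5) by (auto intro: D.subspace_diff)
        moreover have "x - y \<in> Ker2 \<phi>" using n y by (auto simp: Ker2_def)
        ultimately have "x - y = 0" using assms(6) by blast
        with y show ?thesis by simp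
      qed
      with SV S have "fin_dim sD Dbar" unfolding fin_dim_def by blast
      with assms(9) show False by blast
    qed
  qed (use assms(3,4) in \<open>auto simp: lin_dual_def\<close>)
  interpret W: witt_rep sD \<phi> sM t
  proof unfold_locales
    show "t a d (t a' d' v) - t a' d' (t a d v) = t (a + a') (sD (\<phi> a' d) d' - sD (\<phi> a d') d) v" for a a' d d' v
      using act_bracket[of "Poly_Mapping.single a d" "Poly_Mapping.single a' d'" v]
      by (simp add: t_def bracketW_single[OF assms(4)])
  qed (simp_all add: t_def act_v act_x single_add single_scale)
  have wt: "W.wt l = weight_space sM act l" for l
    by (simp add: W.wt_def weight_space_def t_def)
  show ?thesis
  proof (cases "\<exists>v. v \<noteq> 0 \<and> (\<forall>a d. t a d v = 0)")
    case True
    \<comment> \<open>A nonzero vector killed by W spans a submodule, hence all of M.\<close>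
    then obtain v where v: "v \<noteq> 0" "\<And>a d. t a d v = 0" by blast
    have act_v0: "act x w = 0" if "w \<in> M.span {v}" for x w
      using that by (auto simp: M.span_singleton act_v act_t v)
    then have "submodule sM act (M.span {v})" by (simp add: submodule_def M.span_zero)
    moreover have "v \<in> M.span {v}" by (simp add: M.span_base)
    ultimately have sp: "M.span {v} = UNIV" using assms(11) v(1) by (auto simp: simple_module_def)
    have "M.dim (M.span {v}) = card {v}" by (rule M.dim_span_eq_card_independent) (simp add: v)
    with sp act_v0 show ?thesis by auto
  next
    case nontriv: False
    obtain n where n: "\<And>l. l \<in> lin_dual sD \<Longrightarrow> fin_dim sM (W.wt l) \<and> M.dim (W.wt l) \<le> n"
      using assms(12) by (auto simp: bounded_module_def wt)
    have "\<exists>l. \<exists>v\<in>W.wt l. v \<noteq> 0"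
    proof -
      obtain v :: 'm where v: "v \<noteq> 0" using assms(11) by (auto simp: simple_module_def)
      obtain f where "\<forall>l. f l \<in> W.wt l" "v = (\<Sum>l | f l \<noteq> 0. f l)"
        using assms(12) unfolding bounded_module_def weight_module_def wt by metis
      moreover from this(2) v have "\<exists>l. f l \<noteq> 0" by (meson sum.not_neutral_contains_not_neutral)
      ultimately show ?thesis by blast
    qed
    interpret nontrivial_witt_rep sD \<phi> sM t n
    proof unfold_locales
      show "\<exists>C. finite C \<and> card C \<le> n \<and> W.wt l \<subseteq> M.span C" for l
      proof (cases "l \<in> lin_dual sD")
        case True
        then obtain C0 where C0: "finite C0" "M.span C0 = W.wt l" using n by (auto simp: fin_dim_def)
        obtain C where C: "C \<subseteq> W.wt l" "M.independent C" "W.wt l \<subseteq> M.span C" "card C = M.dim (W.wt l)"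
          by (rule M.basis_exists)
        then show ?thesis
          using n[OF True] M.independent_span_bound[OF C0(1) C(2)] C0 by auto
      next
        case False
        then have "W.wt l \<subseteq> M.span {}" using W.wt_nonzero_dual by auto
        then show ?thesis by (intro exI[of _ "{}"]) auto
      qed
    qed (use nontriv \<open>\<exists>l. \<exists>v\<in>W.wt l. v \<noteq> 0\<close> in blast)+
    obtain \<Lambda> B \<kappa> and u :: "'g \<Rightarrow> 'm" where line: "\<Lambda> \<in> lin_dual sD" "small B" "\<And>b. nz B b \<Longrightarrow> u b \<noteq> 0"
      "\<And>a b d. ind2 B b a \<Longrightarrow> t a d (u b) = sM (\<phi> b d + \<Lambda> d + \<kappa> * \<phi> a d) (u (a + b))"
      by (rule generic_line) blast
    interpret witt_line sD \<phi> sM t n \<Lambda> B \<kappa> u by unfold_locales (fact line)+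
    have simple: "V = {0} \<or> V = UNIV" if V: "M.subspace V" "\<And>a d v. v \<in> V \<Longrightarrow> t a d v \<in> V" for V
    proof -
      have "submodule sM act V"
        unfolding submodule_def act_t using V by (auto intro: M.subspace_sum)
      with assms(11) show ?thesis by (simp add: simple_module_def)
    qed
    from classification[OF assms(8) simple act_t] show ?thesis by blast
  qed
qed

end
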